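(* Consider the infinite-horizon symmetric Cobb–Douglas economy described in the context, with $\psi_c(t)=e^{-rt}$ and $\psi_x(t)=e^{-rt}\mathcal{E}_x(t)\equiv e^{-rt+\sigma W(t)}$, $\sigma>0$, for a one-dimensional Brownian motion $W$ and some $r$ such that $\sqrt{2r}>\frac{\sigma\alpha}{1-\alpha-\beta}$. Let $C_*=l_0\theta$ be the optimal aggregate public good contribution of the social planner problem and let $\hat C=\kappa\theta$ be the aggregate public good contribution in the symmetric Nash equilibrium (with $l_0,\kappa,\theta$ as in the context). Then for any $n\ge1$ $$\frac{\hat C(t)}{C_*(t)}=\frac{\kappa}{l_0}=\frac{\alpha+\beta}{n\alpha+\beta}\le1.$$
   Context: Economy. Horizon $T=\infty$, $n$ agents, filtered probability space $(\Omega,\mathcal{F},\{\mathcal{F}_t\},P)$ satisfying the usual conditions, constant discount rate $r>0$. All agents have the same initial wealth $w_o>0$ and utility $u(x,c)=\frac{x^\alpha c^\beta}{\alpha+\beta}$ with $\alpha,\beta\in(0,1)$, $\alpha+\beta<1$. Integrals $\int_0^\infty(\cdot)\,dC(t)$ against nondecreasing right-continuous $C$ include the point mass $C(0)$ at $t=0$ (convention $C(0-)=0$); the same for $d\theta$. Social planner problem (weights $1/n$): maximize $\sum_{i=1}^n\frac1nE[\int_0^\infty e^{-rt}u(x^i(t),C(t))dt]$, $C:=\sum_iC^i$, over nonnegative optional $(x^1,\dots,x^n,C^1,\dots,C^n)$ with each $C^i$ right-continuous, nondecreasing, $C^i(0-)=0$, and $\sum_{i=1}^nE[\int_0^\infty\psi_x(t)x^i(t)dt+\int_0^\infty\psi_c(t)dC^i(t)]\le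 nw_o$. Game: each agent $i$ chooses nonnegative optional $(x^i,C^i)$ with $C^i$ right-continuous, nondecreasing, $C^i(0-)=0$, $E[\int_0^\infty\psi_xx^idt+\int_0^\infty\psi_cdC^i]\le w_o$, to maximize $E[\int_0^\infty e^{-rt}u(x^i(t),C(t))dt]$, taking $C^{-i}=\sum_{j\ne i}C^j$ as given; a Nash equilibrium is a tuple of mutual best replies, symmetric if all agents use the same strategy. With $\mathcal{E}_x(t)=e^{\sigma W(t)}$ and $\mathcal{E}_c\equiv1$, set $\delta:=\frac\beta\alpha(\frac{\alpha+\beta}\alpha)^{\frac1{\alpha-1}}$, $$A:=E\Big[\int_0^\infty\delta e^{-ru}\inf_{0\le s\le u}\mathcal{E}_x^{-\frac\alpha{1-\alpha}}(u-s)\,du\Big],\qquad\theta(t):=\sup_{0\le s\le t}\mathcal{E}_x^{-\frac\alpha{1-\alpha-\beta}}(s),$$ $$\gamma(t):=\frac1A\Big[\frac{\alpha+\beta}\alpha\,\mathcal{E}_x(t)\inf_{0\le s\le t}\mathcal{E}_x^{\frac{\alpha\beta}{1-\alpha-\beta}}(s)\Big]^{-\frac1{1-\alpha}},$$ $$l_0:=\frac{nw_o}{E[\int_0^\infty\psi_x\gamma\,dt+\int_0^\infty\psi_c\,d\theta]},\qquad\kappa:=\frac{w_o}{E[\int_0^\infty\psi_x\gamma\,dt+\frac1n\int_0^\infty\psi_c\,d\theta]}.$$ The social planner's optimal aggregate contribution is $C_*=l_0\theta$ and each agent's symmetric Nash equilibrium contribution is $\hat C^i=\frac\kappa n\theta$,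 so $\hat C=\sum_i\hat C^i=\kappa\theta$. *)

theory Defs
  imports "HOL-Probability.Probability"
begin

text \<open>
  Processes are curried functions \<^typ>\<open>real \<Rightarrow> 'a \<Rightarrow> real\<close> (time first); only their values at
  times \<open>t \<ge> 0\<close> matter, and a filtration is a family \<^typ>\<open>real \<Rightarrow> 'a measure\<close> of which only the
  members with index \<open>t \<ge> 0\<close> matter.
\<close>

section \<open>Filtered probability space and Brownian motion\<close>

definition usual_conditions :: "'a measure \<Rightarrow> (real \<Rightarrow> 'a measure) \<Rightarrow> bool" where
  "usual_conditions M F \<longleftrightarrow>
     prob_space M \<and> complete_measure M \<and>
     (\<forall>t\<ge>0. subalgebra M (F t)) \<and>
     (\<forall>s\<ge>0. \<forall>t\<ge>s. sets (F s) \<subseteq> sets (F t)) \<and>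
     null_sets M \<subseteq> sets (F 0) \<and>
     (\<forall>t\<ge>0. sets (F t) = (\<Inter>s\<in>{t<..}. sets (F s)))"

definition adapted :: "(real \<Rightarrow> 'a measure) \<Rightarrow> (real \<Rightarrow> 'a \<Rightarrow> real) \<Rightarrow> bool" where
  "adapted F X \<longleftrightarrow> (\<forall>t\<ge>0. X t \<in> borel_measurable (F t))"

definition brownian_motion ::
    "'a measure \<Rightarrow> (real \<Rightarrow> 'a measure) \<Rightarrow> (real \<Rightarrow> 'a \<Rightarrow> real) \<Rightarrow> bool" where
  "brownian_motion M F W \<longleftrightarrow>
     adapted F W \<and>
     (AE \<omega> in M. W 0 \<omega> = 0) \<and>
     (\<forall>s\<ge>0. \<forall>t>s.
        distributed M lborel (\<lambda>\<omega>. W t \<omega> - W s \<omega>) (normal_density 0 (sqrt (t - s))) \<and>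
        prob_space.indep_set M (sets (F s))
          {(\<lambda>\<omega>. W t \<omega> - W s \<omega>) -` B \<inter> space M | B. B \<in> sets borel}) \<and>
     (AE \<omega> in M. continuous_on {0..} (\<lambda>t. W t \<omega>))"

definition cadlag_on :: "'a set \<Rightarrow> (real \<Rightarrow> 'a \<Rightarrow> real) \<Rightarrow> bool" where
  "cadlag_on \<Omega> X \<longleftrightarrow>
     (\<forall>\<omega>\<in>\<Omega>. (\<forall>t\<ge>0. continuous (at_right t) (\<lambda>s. X s \<omega>)) \<and>
             (\<forall>t>0. \<exists>l. ((\<lambda>s. X s \<omega>) \<longlongrightarrow> l) (at_left t)))"

definition optional_sigma :: "'a measure \<Rightarrow> (real \<Rightarrow> 'a measure) \<Rightarrow> (real \<times> 'a) measure" where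
  "optional_sigma M F =
     sigma ({0..} \<times> space M)
       {{(t, \<omega>). 0 \<le> t \<and> \<omega> \<in> space M \<and> X t \<omega> \<in> B} | X B.
          adapted F X \<and> cadlag_on (space M) X \<and> B \<in> sets borel}"

definition optional_process ::
    "'a measure \<Rightarrow> (real \<Rightarrow> 'a measure) \<Rightarrow> (real \<Rightarrow> 'a \<Rightarrow> real) \<Rightarrow> bool" where
  "optional_process M F X \<longleftrightarrow> (\<lambda>(t, \<omega>). X t \<omega>) \<in> borel_measurable (optional_sigma M F)"

section \<open>Plans, costs and payoffs\<close>

definition admissible_plan ::
    "'a measure \<Rightarrow> (real \<Rightarrow> 'a measure) \<Rightarrow>
     (real \<Rightarrow> 'a \<Rightarrow> real) \<Rightarrow> (real \<Rightarrow> 'a \<Rightarrow> real) \<Rightarrow> bool" where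
  "admissible_plan M F x C \<longleftrightarrow>
     optional_process M F x \<and> optional_process M F C \<and>
     (\<forall>\<omega>\<in>space M. (\<forall>t\<ge>0. 0 \<le> x t \<omega> \<and> 0 \<le> C t \<omega>) \<and>
                   (\<forall>s\<ge>0. \<forall>t\<ge>s. C s \<omega> \<le> C t \<omega>) \<and>
                   (\<forall>t\<ge>0. continuous (at_right t) (\<lambda>s. C s \<omega>)))"

text \<open>
  Lebesgue-Stieltjes integral of \<open>f\<close> over \<open>[0, \<infinity>)\<close>. Extending the integrator by \<open>0\<close> to negative
  times implements the convention \<open>C(0-) = 0\<close>: the measure has mass \<open>C(0)\<close> at time \<open>0\<close>.
\<close>

definition stieltjes :: "(real \<Rightarrow> real) \<Rightarrow> (real \<Rightarrow> real) \<Rightarrow> ennreal" where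
  "stieltjes f C =
     (\<integral>\<^sup>+ t. ennreal (f t) * indicator {0..} t \<partial>interval_measure (\<lambda>t. if t < 0 then 0 else C t))"

definition time_integral :: "(real \<Rightarrow> real) \<Rightarrow> ennreal" where
  "time_integral f = (\<integral>\<^sup>+ t. ennreal (f t) * indicator {0..} t \<partial>lborel)"

definition plan_cost ::
    "'a measure \<Rightarrow> (real \<Rightarrow> 'a \<Rightarrow> real) \<Rightarrow> (real \<Rightarrow> 'a \<Rightarrow> real) \<Rightarrow>
     (real \<Rightarrow> 'a \<Rightarrow> real) \<Rightarrow> (real \<Rightarrow> 'a \<Rightarrow> real) \<Rightarrow> ennreal" where
  "plan_cost M \<psi>x \<psi>c x C =
     (\<integral>\<^sup>+ \<omega>. time_integral (\<lambda>t. \<psi>x t \<omega> * x t \<omega>)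
            + stieltjes (\<lambda>t. \<psi>c t \<omega>) (\<lambda>t. C t \<omega>) \<partial>M)"

definition cobb_douglas :: "real \<Rightarrow> real \<Rightarrow> real \<Rightarrow> real \<Rightarrow> real" where
  "cobb_douglas \<alpha> \<beta> x c = x powr \<alpha> * c powr \<beta> / (\<alpha> + \<beta>)"

definition payoff ::
    "'a measure \<Rightarrow> real \<Rightarrow> real \<Rightarrow> real \<Rightarrow>
     (real \<Rightarrow> 'a \<Rightarrow> real) \<Rightarrow> (real \<Rightarrow> 'a \<Rightarrow> real) \<Rightarrow> ennreal" where
  "payoff M r \<alpha> \<beta> x C =
     (\<integral>\<^sup>+ \<omega>. time_integral (\<lambda>t. exp (- r * t) * cobb_douglas \<alpha> \<beta> (x t \<omega>) (C t \<omega>)) \<partial>M)"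

definition aggregate :: "nat \<Rightarrow> (nat \<Rightarrow> real \<Rightarrow> 'a \<Rightarrow> real) \<Rightarrow> real \<Rightarrow> 'a \<Rightarrow> real" where
  "aggregate n C t \<omega> = (\<Sum>i<n. C i t \<omega>)"

section \<open>Social planner and game\<close>

definition planner_feasible ::
    "'a measure \<Rightarrow> (real \<Rightarrow> 'a measure) \<Rightarrow> nat \<Rightarrow> real \<Rightarrow>
     (real \<Rightarrow> 'a \<Rightarrow> real) \<Rightarrow> (real \<Rightarrow> 'a \<Rightarrow> real) \<Rightarrow>
     (nat \<Rightarrow> real \<Rightarrow> 'a \<Rightarrow> real) \<Rightarrow> (nat \<Rightarrow> real \<Rightarrow> 'a \<Rightarrow> real) \<Rightarrow> bool" where
  "planner_feasible M F n w \<psi>x \<psi>c x C \<longleftrightarrow>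
     (\<forall>i<n. admissible_plan M F (x i) (C i)) \<and>
     (\<Sum>i<n. plan_cost M \<psi>x \<psi>c (x i) (C i)) \<le> ennreal (real n * w)"

definition planner_value ::
    "'a measure \<Rightarrow> nat \<Rightarrow> real \<Rightarrow> real \<Rightarrow> real \<Rightarrow>
     (nat \<Rightarrow> real \<Rightarrow> 'a \<Rightarrow> real) \<Rightarrow> (nat \<Rightarrow> real \<Rightarrow> 'a \<Rightarrow> real) \<Rightarrow> ennreal" where
  "planner_value M n r \<alpha> \<beta> x C =
     (\<Sum>i<n. ennreal (1 / real n) * payoff M r \<alpha> \<beta> (x i) (aggregate n C))"

definition planner_optimal ::
    "'a measure \<Rightarrow> (real \<Rightarrow> 'a measure) \<Rightarrow> nat \<Rightarrow> real \<Rightarrow> real \<Rightarrow> real \<Rightarrow> real \<Rightarrow>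
     (real \<Rightarrow> 'a \<Rightarrow> real) \<Rightarrow> (real \<Rightarrow> 'a \<Rightarrow> real) \<Rightarrow>
     (nat \<Rightarrow> real \<Rightarrow> 'a \<Rightarrow> real) \<Rightarrow> (nat \<Rightarrow> real \<Rightarrow> 'a \<Rightarrow> real) \<Rightarrow> bool" where
  "planner_optimal M F n w r \<alpha> \<beta> \<psi>x \<psi>c x C \<longleftrightarrow>
     planner_feasible M F n w \<psi>x \<psi>c x C \<and>
     (\<forall>y D. planner_feasible M F n w \<psi>x \<psi>c y D \<longrightarrow>
        planner_value M n r \<alpha> \<beta> y D \<le> planner_value M n r \<alpha> \<beta> x C)"

definition strategy_feasible ::
    "'a measure \<Rightarrow> (real \<Rightarrow> 'a measure) \<Rightarrow> real \<Rightarrow>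
     (real \<Rightarrow> 'a \<Rightarrow> real) \<Rightarrow> (real \<Rightarrow> 'a \<Rightarrow> real) \<Rightarrow>
     (real \<Rightarrow> 'a \<Rightarrow> real) \<Rightarrow> (real \<Rightarrow> 'a \<Rightarrow> real) \<Rightarrow> bool" where
  "strategy_feasible M F w \<psi>x \<psi>c x C \<longleftrightarrow>
     admissible_plan M F x C \<and> plan_cost M \<psi>x \<psi>c x C \<le> ennreal w"

definition nash_equilibrium ::
    "'a measure \<Rightarrow> (real \<Rightarrow> 'a measure) \<Rightarrow> nat \<Rightarrow> real \<Rightarrow> real \<Rightarrow> real \<Rightarrow> real \<Rightarrow>
     (real \<Rightarrow> 'a \<Rightarrow> real) \<Rightarrow> (real \<Rightarrow> 'a \<Rightarrow> real) \<Rightarrow>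
     (nat \<Rightarrow> real \<Rightarrow> 'a \<Rightarrow> real) \<Rightarrow> (nat \<Rightarrow> real \<Rightarrow> 'a \<Rightarrow> real) \<Rightarrow> bool" where
  "nash_equilibrium M F n w r \<alpha> \<beta> \<psi>x \<psi>c x C \<longleftrightarrow>
     (\<forall>i<n. strategy_feasible M F w \<psi>x \<psi>c (x i) (C i)) \<and>
     (\<forall>i<n. \<forall>y D. strategy_feasible M F w \<psi>x \<psi>c y D \<longrightarrow>
        payoff M r \<alpha> \<beta> y (\<lambda>t \<omega>. D t \<omega> + (\<Sum>j\<in>{..<n} - {i}. C j t \<omega>))
          \<le> payoff M r \<alpha> \<beta> (x i) (aggregate n C))"

definition symmetric_nash_equilibrium ::
    "'a measure \<Rightarrow> (real \<Rightarrow> 'a measure) \<Rightarrow> nat \<Rightarrow> real \<Rightarrow> real \<Rightarrow> real \<Rightarrow> real \<Rightarrow>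
     (real \<Rightarrow> 'a \<Rightarrow> real) \<Rightarrow> (real \<Rightarrow> 'a \<Rightarrow> real) \<Rightarrow>
     (nat \<Rightarrow> real \<Rightarrow> 'a \<Rightarrow> real) \<Rightarrow> (nat \<Rightarrow> real \<Rightarrow> 'a \<Rightarrow> real) \<Rightarrow> bool" where
  "symmetric_nash_equilibrium M F n w r \<alpha> \<beta> \<psi>x \<psi>c x C \<longleftrightarrow>
     nash_equilibrium M F n w r \<alpha> \<beta> \<psi>x \<psi>c x C \<and>
     (\<forall>i<n. \<forall>j<n. \<forall>t\<ge>0. \<forall>\<omega>\<in>space M. x i t \<omega> = x j t \<omega> \<and> C i t \<omega> = C j t \<omega>)"

section \<open>The explicit solution\<close>

definition delta_const :: "real \<Rightarrow> real \<Rightarrow> real" where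
  "delta_const \<alpha> \<beta> = \<beta> / \<alpha> * ((\<alpha> + \<beta>) / \<alpha>) powr (1 / (\<alpha> - 1))"

text \<open>
  The expectations below are of nonnegative quantities and are formed in \<^typ>\<open>ennreal\<close>.
  \<^const>\<open>enn2real\<close> maps \<open>\<infinity>\<close> to \<open>0\<close>, so the constants are meaningful only where they are finite.
\<close>

definition A_const :: "'a measure \<Rightarrow> real \<Rightarrow> real \<Rightarrow> real \<Rightarrow> (real \<Rightarrow> 'a \<Rightarrow> real) \<Rightarrow> real" where
  "A_const M r \<alpha> \<beta> \<E>x =
     enn2real (\<integral>\<^sup>+ \<omega>. time_integral (\<lambda>u. delta_const \<alpha> \<beta> * exp (- r * u) *
       (INF s\<in>{0..u}. \<E>x (u - s) \<omega> powr (- (\<alpha> / (1 - \<alpha>))))) \<partial>M)"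

definition theta_process :: "real \<Rightarrow> real \<Rightarrow> (real \<Rightarrow> 'a \<Rightarrow> real) \<Rightarrow> real \<Rightarrow> 'a \<Rightarrow> real" where
  "theta_process \<alpha> \<beta> \<E>x t \<omega> = (SUP s\<in>{0..t}. \<E>x s \<omega> powr (- (\<alpha> / (1 - \<alpha> - \<beta>))))"

definition gamma_process ::
    "'a measure \<Rightarrow> real \<Rightarrow> real \<Rightarrow> real \<Rightarrow> (real \<Rightarrow> 'a \<Rightarrow> real) \<Rightarrow> real \<Rightarrow> 'a \<Rightarrow> real" where
  "gamma_process M r \<alpha> \<beta> \<E>x t \<omega> =
     1 / A_const M r \<alpha> \<beta> \<E>x *
     ((\<alpha> + \<beta>) / \<alpha> * \<E>x t \<omega> *
       (INF s\<in>{0..t}. \<E>x s \<omega> powr (\<alpha> * \<beta> / (1 - \<alpha> - \<beta>)))) powr (- (1 / (1 - \<alpha>)))"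

definition l0_const ::
    "'a measure \<Rightarrow> nat \<Rightarrow> real \<Rightarrow> (real \<Rightarrow> 'a \<Rightarrow> real) \<Rightarrow> (real \<Rightarrow> 'a \<Rightarrow> real) \<Rightarrow>
     (real \<Rightarrow> 'a \<Rightarrow> real) \<Rightarrow> (real \<Rightarrow> 'a \<Rightarrow> real) \<Rightarrow> real" where
  "l0_const M n w \<psi>x \<psi>c \<gamma> \<theta> =
     real n * w / enn2real (\<integral>\<^sup>+ \<omega>. time_integral (\<lambda>t. \<psi>x t \<omega> * \<gamma> t \<omega>)
       + stieltjes (\<lambda>t. \<psi>c t \<omega>) (\<lambda>t. \<theta> t \<omega>) \<partial>M)"

definition kappa_const ::
    "'a measure \<Rightarrow> nat \<Rightarrow> real \<Rightarrow> (real \<Rightarrow> 'a \<Rightarrow> real) \<Rightarrow> (real \<Rightarrow> 'a \<Rightarrow> real) \<Rightarrow>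
     (real \<Rightarrow> 'a \<Rightarrow> real) \<Rightarrow> (real \<Rightarrow> 'a \<Rightarrow> real) \<Rightarrow> real" where
  "kappa_const M n w \<psi>x \<psi>c \<gamma> \<theta> =
     w / enn2real (\<integral>\<^sup>+ \<omega>. time_integral (\<lambda>t. \<psi>x t \<omega> * \<gamma> t \<omega>)
       + ennreal (1 / real n) * stieltjes (\<lambda>t. \<psi>c t \<omega>) (\<lambda>t. \<theta> t \<omega>) \<partial>M)"

end

theory Submission
  imports Defs
begin

text \<open>
  Put \<open>B = - W\<close>, \<open>S(t) = sup {B s | s \<le> t}\<close>, \<open>l = \<sigma> \<alpha> / (1 - \<alpha> - \<beta>)\<close> and \<open>\<mu> = \<sigma> \<alpha> / (1 - \<alpha>)\<close>. Then
  \<open>\<theta> = exp (l S)\<close>, and \<open>\<psi>x \<gamma>\<close> is a constant multiple of \<open>exp (- r t + l S - \<mu> (S - B)) / A\<close>. At an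
  independent exponential time of rate \<open>r\<close> the variables \<open>S\<close> and \<open>S - B\<close> are independent, and \<open>S - B\<close> is
  distributed as the running maximum of \<open>W\<close>, whose Laplace transform at \<open>\<mu>\<close> is what defines \<open>A\<close>.
  Hence the private cost \<open>E \<integral> \<psi>x \<gamma> dt\<close> equals \<open>\<alpha> / \<beta>\<close> times the public cost \<open>E \<integral> \<psi>c d\<theta>\<close>, because the
  latter is \<open>r E \<integral> exp (- r t) \<theta> dt\<close>; the ratio of the two budget constants is then elementary.
  The Wiener-Hopf independence is obtained for the walk on the grid of mesh \<open>1 / m\<close> by splitting it
  at its first maximum, and passes to the limit by path continuity and dominated convergence.
\<close>

section \<open>Wiener-Hopf factorization for random walks\<close>

text \<open>No Laplace transform is ever evaluated. Let v1 be the discounted moment of exp (l S) and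
  v2 the discounted transform of the maximum of W at \<mu>. The factorization turns the private
  integrand into r v1 v2, while A is \<delta> v2, so v2 cancels; what survives is the constant
  factor of \<gamma> divided by \<delta>, which is \<alpha> / \<beta>. The remaining v1 is common to
  both budget constants. Hence only positivity and finiteness of v1 and v2 matter, and finiteness of
  v1 is where sqrt (2 r) > l enters. In continuous time the splitting time ranges over a continuum;
  on the grid it can be summed over. The exponential time then becomes a geometric one with weights
  q^n, q = exp (- r / m), and the split becomes a Cauchy product. The identities are stated as
  products in \<open>ennreal\<close>, without division, because on the grid the factors may a priori
  be infinite.\<close>

definition psum :: "(nat \<Rightarrow> real) \<Rightarrow> nat \<Rightarrow> real" where
  "psum x n = (\<Sum>i<n. x i)"

definition pmax :: "(nat \<Rightarrow> real) \<Rightarrow> nat \<Rightarrow> real" where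
  "pmax x n = Max (psum x ` {..n})"

text \<open>Strict before the splitting time, weak after it (\<open>stays_nonpos\<close>): this
  asymmetry gives every path exactly one splitting time even if the maximum is attained
  repeatedly.\<close>

definition strict_record :: "(nat \<Rightarrow> real) \<Rightarrow> nat \<Rightarrow> bool" where
  "strict_record x k \<longleftrightarrow> (\<forall>j<k. psum x j < psum x k)"

definition stays_nonpos :: "(nat \<Rightarrow> real) \<Rightarrow> nat \<Rightarrow> bool" where
  "stays_nonpos x m \<longleftrightarrow> (\<forall>j\<le>m. psum x j \<le> 0)"

lemma psum_0 [simp]: "psum x 0 = 0"
  by (simp add: psum_def)

lemma psum_comb_seq:
  "psum (comb_seq k x y) n = (if n \<le> k then psum x n else psum x k + psum y (n - k))"
proof (cases "n \<le> k")
  case True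
  then show ?thesis by (auto simp: psum_def comb_seq_def intro!: sum.cong)
next
  case False
  define d where "d = n - k"
  have n: "n = k + d" using False by (simp add: d_def)
  have "psum (comb_seq k x y) (k + d) = psum x k + psum y d"
    by (induction d) (auto simp: psum_def comb_seq_def)
  then show ?thesis using False n by auto
qed

lemma pmax_ge: "j \<le> n \<Longrightarrow> psum x j \<le> pmax x n"
  by (simp add: pmax_def)

lemma pmax_attained: "\<exists>j\<le>n. pmax x n = psum x j"
proof -
  have "pmax x n \<in> psum x ` {..n}"
    unfolding pmax_def by (rule Max_in) auto
  then show ?thesis by auto
qed

lemma pmax_eqI: "k \<le> n \<Longrightarrow> (\<And>j. j \<le> n \<Longrightarrow> psum x j \<le> psum x k) \<Longrightarrow> pmax x n = psum x k"
  unfolding pmax_def by (rule Max_eqI) auto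

lemma pmax_nonneg: "0 \<le> pmax x n"
  using pmax_ge[of 0 n x] by (simp add: psum_def)

text \<open>The least index attaining \<open>pmax x n\<close> qualifies. For two distinct candidates
  the weak inequality of the earlier contradicts the strict one of the later.\<close>

lemma unique_first_argmax:
  "\<exists>!k. k \<le> n \<and> strict_record x k \<and> (\<forall>j. k < j \<and> j \<le> n \<longrightarrow> psum x j \<le> psum x k)"
proof -
  define k where "k = (LEAST j. psum x j = pmax x n)"
  obtain j where j: "j \<le> n" "psum x j = pmax x n" using pmax_attained[of n x] by auto
  have k1: "psum x k = pmax x n" unfolding k_def by (rule LeastI[of _ j]) (fact j)
  have k2: "k \<le> j" unfolding k_def by (rule Least_le) (fact j)
  have k3: "psum x i < psum x k" if "i < k" for i
  proof -
    have "psum x i \<noteq> pmax x n" using not_less_Least that unfolding k_def by blast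
    moreover have "psum x i \<le> pmax x n" using that k2 j by (intro pmax_ge) auto
    ultimately show ?thesis using k1 by auto
  qed
  show ?thesis
  proof (rule ex1I[of _ k])
    show "k \<le> n \<and> strict_record x k \<and> (\<forall>j. k < j \<and> j \<le> n \<longrightarrow> psum x j \<le> psum x k)"
      using k1 k2 k3 j pmax_ge by (auto simp: strict_record_def)
    fix l assume l: "l \<le> n \<and> strict_record x l \<and> (\<forall>j. l < j \<and> j \<le> n \<longrightarrow> psum x j \<le> psum x l)"
    show "l = k"
    proof (rule linorder_cases[of l k])
      assume "l < k" then have "psum x k \<le> psum x l" "psum x l < psum x k" using l k2 j k3 by auto
      then show ?thesis by simp
    next
      assume "k < l" then have "psum x k < psum x l" using l by (auto simp: strict_record_def)
      moreover have "psum x l \<le> psum x k" using k1 l pmax_ge by auto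
      ultimately show ?thesis by simp
    qed auto
  qed
qed

text \<open>Tonelli for the counting measure, once the inner sum is extended by zeros.\<close>

lemma suminf_cauchy_product_ennreal:
  fixes a b :: "nat \<Rightarrow> ennreal"
  shows "(\<Sum>n. \<Sum>k\<le>n. a k * b (n - k)) = (\<Sum>k. a k) * (\<Sum>m. b m)"
proof -
  have "(\<Sum>n. \<Sum>k\<le>n. a k * b (n - k)) = (\<Sum>n. \<Sum>k. (if k \<le> n then a k * b (n - k) else 0))"
  proof (rule suminf_cong)
    fix n
    have "(\<Sum>k. (if k \<le> n then a k * b (n - k) else 0)) = (\<Sum>k\<le>n. (if k \<le> n then a k * b (n - k) else 0))"
      by (rule suminf_finite) auto
    then show "(\<Sum>k\<le>n. a k * b (n - k)) = (\<Sum>k. (if k \<le> n then a k * b (n - k) else 0))"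
      by simp
  qed
  also have "\<dots> = (\<integral>\<^sup>+n. (\<Sum>k. (if k \<le> n then a k * b (n - k) else 0)) \<partial>count_space UNIV)"
    by (simp add: nn_integral_count_space_nat)
  also have "\<dots> = (\<Sum>k. \<integral>\<^sup>+n. (if k \<le> n then a k * b (n - k) else 0) \<partial>count_space UNIV)"
    by (rule nn_integral_suminf) auto
  also have "\<dots> = (\<Sum>k. \<Sum>n. (if k \<le> n then a k * b (n - k) else 0))"
    by (simp add: nn_integral_count_space_nat)
  also have "\<dots> = (\<Sum>k. a k * (\<Sum>m. b m))"
  proof (rule suminf_cong)
    fix k
    let ?f = "\<lambda>n. (if k \<le> n then a k * b (n - k) else 0)"
    have "suminf ?f = (\<Sum>m. ?f (m + k)) + (\<Sum>i<k. ?f i)"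
      by (rule suminf_offset) auto
    also have "\<dots> = (\<Sum>m. a k * b m)" by simp
    finally show "suminf ?f = a k * (\<Sum>m. b m)" by simp
  qed
  finally show ?thesis by (simp add: mult.commute[of _ "suminf b"])
qed

locale iid_walk = sequence_space N for N :: "real measure" +
  assumes sets_N: "sets N = sets borel"
begin

lemma measurable_coord: "(\<lambda>x. x i) \<in> borel_measurable S"
  using measurable_component_singleton[of i UNIV "\<lambda>_. N"] by (simp add: sets_N cong: measurable_cong_sets)

lemma measurable_psum [measurable]: "(\<lambda>x. psum x n) \<in> borel_measurable S"
  unfolding psum_def using measurable_coord by measurable

lemma measurable_pmax [measurable]: "(\<lambda>x. pmax x n) \<in> borel_measurable S"
  unfolding pmax_def by measurable

lemma measurable_strict_record [measurable]: "Measurable.pred S (\<lambda>x. strict_record x n)"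
  unfolding strict_record_def by measurable

lemma measurable_stays_nonpos [measurable]: "Measurable.pred S (\<lambda>x. stays_nonpos x n)"
  unfolding stays_nonpos_def by measurable

text \<open>This is independence of the first \<open>k\<close> increments from the later ones:
  following \<open>k\<close> terms of one iid sequence by an independent copy reproduces the
  law.\<close>

lemma nn_integral_comb_seq:
  assumes [measurable]: "f \<in> borel_measurable S"
  shows "(\<integral>\<^sup>+x. f x \<partial>S) = (\<integral>\<^sup>+x. \<integral>\<^sup>+y. f (comb_seq k x y) \<partial>S \<partial>S)"
proof -
  have "(\<integral>\<^sup>+x. f x \<partial>S) = (\<integral>\<^sup>+x. f x \<partial>(distr (S \<Otimes>\<^sub>M S) S (\<lambda>(x, y). comb_seq k x y)))"
    by (simp add: PiM_comb_seq)
  also have "\<dots> = (\<integral>\<^sup>+(x, y). f (comb_seq k x y) \<partial>(S \<Otimes>\<^sub>M S))"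
    by (subst nn_integral_distr) (auto simp: case_prod_unfold)
  also have "\<dots> = (\<integral>\<^sup>+x. \<integral>\<^sup>+y. f (comb_seq k x y) \<partial>S \<partial>S)"
    by (subst P.nn_integral_fst[symmetric]) (auto simp: case_prod_unfold)
  finally show ?thesis .
qed

text \<open>For \<open>q < 1\<close> and up to the factor 1 - q, this is an expectation at an
  independent geometric time.\<close>

definition generating :: "ennreal \<Rightarrow> (real \<Rightarrow> ennreal) \<Rightarrow> (real \<Rightarrow> ennreal) \<Rightarrow> ennreal" where
  "generating q f g = (\<Sum>n. q ^ n * (\<integral>\<^sup>+x. f (pmax x n) * g (pmax x n - psum x n) \<partial>S))"

text \<open>
  Split the path at the first time \<open>k\<close> at which the maximum over \<open>{..n}\<close> is attained: the increments
  before and after \<open>k\<close> are independent, and the sum over \<open>k\<close> is a convolution.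
\<close>

lemma generating_factorization:
  fixes f g :: "real \<Rightarrow> ennreal"
  assumes [measurable]: "f \<in> borel_measurable borel" "g \<in> borel_measurable borel"
  shows "generating q f g =
    (\<Sum>k. q ^ k * (\<integral>\<^sup>+x. of_bool (strict_record x k) * f (psum x k) \<partial>S)) *
    (\<Sum>m. q ^ m * (\<integral>\<^sup>+x. of_bool (stays_nonpos x m) * g (- psum x m) \<partial>S))"
proof -
  define u where "u k = (\<integral>\<^sup>+x. of_bool (strict_record x k) * f (psum x k) \<partial>S)" for k
  define v where "v m = (\<integral>\<^sup>+x. of_bool (stays_nonpos x m) * g (- psum x m) \<partial>S)" for m
  have *: "(\<integral>\<^sup>+x. f (pmax x n) * g (pmax x n - psum x n) \<partial>S) = (\<Sum>k\<le>n. u k * v (n - k))" for n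
  proof -
    define h where "h k x = of_bool (strict_record x k \<and> (\<forall>j\<in>{k<..n}. psum x j \<le> psum x k)) *
       f (psum x k) * g (psum x k - psum x n)" for k x
    have h_meas [measurable]: "h k \<in> borel_measurable S" for k
      unfolding h_def not_less[symmetric] by measurable
    have "f (pmax x n) * g (pmax x n - psum x n) = (\<Sum>k\<le>n. h k x)" for x
    proof -
      obtain k where k: "k \<le> n" "strict_record x k" "\<forall>j. k < j \<and> j \<le> n \<longrightarrow> psum x j \<le> psum x k"
        and uni: "\<And>l. l \<le> n \<Longrightarrow> strict_record x l \<Longrightarrow> \<forall>j. l < j \<and> j \<le> n \<longrightarrow> psum x j \<le> psum x l \<Longrightarrow> l = k"
        using unique_first_argmax[of n x] by (metis (no_types, lifting))
      have "pmax x n = psum x k"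
      proof (rule pmax_eqI[OF k(1)])
        fix j assume "j \<le> n"
        then show "psum x j \<le> psum x k"
          using k(2,3) by (cases j k rule: linorder_cases) (auto simp: strict_record_def less_imp_le)
      qed
      moreover have "(\<Sum>l\<le>n. h l x) = (\<Sum>l\<in>{k}. h l x)"
        using k(1) uni by (intro sum.mono_neutral_right) (auto simp: h_def)
      ultimately show ?thesis using k by (auto simp: h_def)
    qed
    then have "(\<integral>\<^sup>+x. f (pmax x n) * g (pmax x n - psum x n) \<partial>S) = (\<Sum>k\<le>n. \<integral>\<^sup>+x. h k x \<partial>S)"
      by (simp add: nn_integral_sum)
    also have "\<dots> = (\<Sum>k\<le>n. u k * v (n - k))"
    proof (rule sum.cong[OF refl])
      fix k assume "k \<in> {..n}"
      then have kn: "k \<le> n" by simp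
      have h_comb: "h k (comb_seq k x y) = (of_bool (strict_record x k) * f (psum x k)) *
          (of_bool (stays_nonpos y (n - k)) * g (- psum y (n - k)))" for x y
      proof -
        have "psum (comb_seq k x y) n = psum x k + psum y (n - k)"
          using kn by (auto simp: psum_comb_seq)
        moreover have "strict_record (comb_seq k x y) k \<longleftrightarrow> strict_record x k"
          by (auto simp: strict_record_def psum_comb_seq)
        moreover have "(\<forall>j\<in>{k<..n}. psum (comb_seq k x y) j \<le> psum (comb_seq k x y) k)
            \<longleftrightarrow> stays_nonpos y (n - k)"
        proof
          assume L: "\<forall>j\<in>{k<..n}. psum (comb_seq k x y) j \<le> psum (comb_seq k x y) k"
          show "stays_nonpos y (n - k)"
            unfolding stays_nonpos_def
          proof (intro allI impI)
            fix j assume j: "j \<le> n - k"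
            show "psum y j \<le> 0"
            proof (cases "j = 0")
              case False
              then have "k + j \<in> {k<..n}" using j kn by auto
              with L False show ?thesis by (fastforce simp: psum_comb_seq)
            qed (simp add: psum_def)
          qed
        qed (auto simp: stays_nonpos_def psum_comb_seq)
        ultimately show ?thesis
          by (simp add: h_def psum_comb_seq mult_ac)
      qed
      have "(\<integral>\<^sup>+x. h k x \<partial>S) = (\<integral>\<^sup>+x. \<integral>\<^sup>+y. h k (comb_seq k x y) \<partial>S \<partial>S)"
        by (rule nn_integral_comb_seq) measurable
      also have "\<dots> = (\<integral>\<^sup>+x. (of_bool (strict_record x k) * f (psum x k)) * v (n - k) \<partial>S)"
        unfolding h_comb v_def by (subst nn_integral_cmult) auto
      also have "\<dots> = u k * v (n - k)"
        unfolding u_def by (subst nn_integral_multc) auto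
      finally show "(\<integral>\<^sup>+x. h k x \<partial>S) = u k * v (n - k)" .
    qed
    finally show ?thesis .
  qed
  have "generating q f g = (\<Sum>n. \<Sum>k\<le>n. (q ^ k * u k) * (q ^ (n - k) * v (n - k)))"
    unfolding generating_def *
  proof (rule suminf_cong)
    fix n
    show "q ^ n * (\<Sum>k\<le>n. u k * v (n - k)) = (\<Sum>k\<le>n. (q ^ k * u k) * (q ^ (n - k) * v (n - k)))"
      unfolding sum_distrib_left
    proof (rule sum.cong[OF refl])
      fix k assume "k \<in> {..n}"
      then have "q ^ n = q ^ k * q ^ (n - k)" by (simp flip: power_add)
      then show "q ^ n * (u k * v (n - k)) = (q ^ k * u k) * (q ^ (n - k) * v (n - k))"
        by (simp add: mult_ac)
    qed
  qed
  also have "\<dots> = (\<Sum>k. q ^ k * u k) * (\<Sum>m. q ^ m * v m)"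
    by (rule suminf_cauchy_product_ennreal)
  finally show ?thesis by (simp add: u_def v_def)
qed

text \<open>Both sides are the product of the same four one-sided series. Inserting the constant 1
  takes the place of normalizing, so the one-sided series never have to be identified.\<close>

lemma generating_mult:
  assumes "f \<in> borel_measurable borel" "g \<in> borel_measurable borel"
  shows "generating q f g * generating q (\<lambda>_. 1) (\<lambda>_. 1) =
    generating q f (\<lambda>_. 1) * generating q (\<lambda>_. 1) g"
  using assms by (simp add: generating_factorization mult_ac)

text \<open>Reading the first \<open>n\<close> increments backwards with opposite sign turns the
  drop from the maximum to the endpoint into a maximum; the iid law is invariant under the
  reordering.\<close>

lemma nn_integral_pmax_reversal:
  fixes g :: "real \<Rightarrow> ennreal"
  assumes [measurable]: "g \<in> borel_measurable borel"
  shows "(\<integral>\<^sup>+x. g (pmax x n - psum x n) \<partial>S) = (\<integral>\<^sup>+x. g (pmax (\<lambda>i. - x i) n) \<partial>S)"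
proof -
  \<comment> \<open>Reverses the first \<open>n\<close> coordinates and fixes all others, so it
    permutes the whole index set and preserves the infinite product measure.\<close>
  define p where "p i = (if i < n then n - 1 - i else i)" for i
  have pp: "p (p i) = i" for i by (auto simp: p_def)
  have "inj p" by (metis injI pp)
  have meas: "(\<lambda>x i. x (p i)) \<in> measurable S S"
    by (rule measurable_PiM_single') (auto simp: space_PiM intro!: measurable_component_singleton)
  have distr: "distr S S (\<lambda>x i. x (p i)) = S"
    using distr_PiM_reindex[of UNIV "\<lambda>_. N" p UNIV] \<open>inj p\<close> prob_space by (simp add: restrict_def)
  have *: "psum (\<lambda>i. - x (p i)) j = psum x (n - j) - psum x n" if "j \<le> n" for j x
    using that
  proof (induction j)
    case (Suc j)
    then have "psum x (n - j) = psum x (n - Suc j) + x (n - Suc j)"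
      by (metis Suc_diff_Suc Suc_le_lessD psum_def sum.lessThan_Suc)
    with Suc show ?case by (simp add: psum_def p_def)
  qed (simp add: psum_def)
  have **: "pmax (\<lambda>i. - x (p i)) n = pmax x n - psum x n" for x
  proof -
    obtain j where j: "j \<le> n" "pmax x n = psum x j" using pmax_attained by blast
    have "pmax (\<lambda>i. - x (p i)) n = psum (\<lambda>i. - x (p i)) (n - j)"
      using j pmax_ge[of "n - _" n x] by (intro pmax_eqI) (auto simp: *)
    also have "\<dots> = pmax x n - psum x n" using j by (simp add: *)
    finally show ?thesis .
  qed
  have neg: "(\<lambda>x. pmax (\<lambda>i. - x i) n) \<in> borel_measurable S"
    unfolding pmax_def psum_def using measurable_coord by measurable
  have "(\<integral>\<^sup>+x. g (pmax (\<lambda>i. - x i) n) \<partial>S) = (\<integral>\<^sup>+x. g (pmax (\<lambda>i. - x i) n) \<partial>(distr S S (\<lambda>x i. x (p i))))"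
    by (simp add: distr)
  also have "\<dots> = (\<integral>\<^sup>+x. g (pmax (\<lambda>i. - x (p i)) n) \<partial>S)"
    using neg by (subst nn_integral_distr[OF meas]) auto
  finally show ?thesis by (simp add: **)
qed

end

section \<open>Running maxima, grids and discounting\<close>

definition runmax :: "(real \<Rightarrow> real) \<Rightarrow> real \<Rightarrow> real" where
  "runmax b t = (SUP s\<in>{0..t}. b s)"

definition incr :: "(real \<Rightarrow> real) \<Rightarrow> nat \<Rightarrow> nat \<Rightarrow> real" where
  "incr b m i = b (real (Suc i) / real m) - b (real i / real m)"

context
  fixes b :: "real \<Rightarrow> real"
  assumes cont: "continuous_on {0..} b"
begin

text \<open>Attainment disposes of the boundedness conditions that real suprema and infima would
  otherwise require.\<close>

lemma runmax_attained:
  assumes "0 \<le> t"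
  obtains s where "s \<in> {0..t}" "runmax b t = b s" "\<And>u. u \<in> {0..t} \<Longrightarrow> b u \<le> b s"
proof -
  have "continuous_on {0..t} b" using cont by (rule continuous_on_subset) auto
  then obtain s where s: "s \<in> {0..t}" "\<forall>u\<in>{0..t}. b u \<le> b s"
    using continuous_attains_sup[of "{0..t}" b] assms by auto
  have "runmax b t = b s"
    unfolding runmax_def using s by (intro cSup_eq_maximum) auto
  with s that show thesis by blast
qed

lemma runmax_ge: "0 \<le> s \<Longrightarrow> s \<le> t \<Longrightarrow> b s \<le> runmax b t"
  by (rule runmax_attained[of t]) auto

lemma runmax_mono: "0 \<le> s \<Longrightarrow> s \<le> t \<Longrightarrow> runmax b s \<le> runmax b t"
  by (rule runmax_attained[of s]) (auto intro: runmax_ge)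

lemma SUP_mono_path:
  assumes "0 \<le> t" "mono (\<phi> :: real \<Rightarrow> real)"
  shows "(SUP s\<in>{0..t}. \<phi> (b s)) = \<phi> (runmax b t)"
proof -
  obtain s where s: "s \<in> {0..t}" "runmax b t = b s" "\<And>u. u \<in> {0..t} \<Longrightarrow> b u \<le> b s"
    using runmax_attained assms by blast
  have "(SUP s\<in>{0..t}. \<phi> (b s)) = \<phi> (b s)"
    using s monoD[OF assms(2)] by (intro cSup_eq_maximum) auto
  with s show ?thesis by simp
qed

lemma INF_antimono_path:
  assumes "0 \<le> t" "antimono (\<phi> :: real \<Rightarrow> real)"
  shows "(INF s\<in>{0..t}. \<phi> (b s)) = \<phi> (runmax b t)"
proof -
  obtain s where s: "s \<in> {0..t}" "runmax b t = b s" "\<And>u. u \<in> {0..t} \<Longrightarrow> b u \<le> b s"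
    using runmax_attained assms by blast
  have "(INF s\<in>{0..t}. \<phi> (b s)) = \<phi> (b s)"
    using s antimonoD[OF assms(2)] by (intro cInf_eq_minimum) auto
  with s show ?thesis by simp
qed

text \<open>Provides the right-continuity required of a Stieltjes integrator. Just after
  \<open>t\<close> the path exceeds \<open>b t\<close>, hence the old maximum, by less than
  \<open>e\<close>.\<close>

lemma runmax_right_continuous:
  assumes t: "0 \<le> t"
  shows "continuous (at_right t) (runmax b)"
proof -
  have "(runmax b \<longlongrightarrow> runmax b t) (at_right t)" if "0 \<le> t" for t
    unfolding tendsto_iff
  proof safe
    fix e :: real assume "0 < e"
    have "continuous (at t within {0..}) b"
      using cont that by (simp add: continuous_on_eq_continuous_within)
    then obtain d where d: "d > 0" "\<And>s. 0 \<le> s \<Longrightarrow> dist s t < d \<Longrightarrow> dist (b s) (b t) < e"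
      using \<open>0 < e\<close> unfolding continuous_within_eps_delta by auto
    have "dist (runmax b u) (runmax b t) < e" if u: "t < u" "u < t + d" for u
    proof -
      have "0 \<le> u" using u \<open>0 \<le> t\<close> by simp
      then obtain s where s: "s \<in> {0..u}" "runmax b u = b s"
        by (rule runmax_attained)
      have "b s < runmax b t + e"
      proof (cases "s \<le> t")
        case True then show ?thesis using runmax_ge[of s t] s \<open>0 < e\<close> by auto
      next
        case False
        then have "\<bar>b s - b t\<bar> < e" using d(2)[of s] s u by (auto simp: dist_real_def)
        moreover have "b t \<le> runmax b t" using runmax_ge \<open>0 \<le> t\<close> by auto
        ultimately show ?thesis by linarith
      qed
      moreover have "runmax b t \<le> runmax b u" using runmax_mono \<open>0 \<le> t\<close> u by auto
      ultimately show ?thesis using s by (auto simp: dist_real_def)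
    qed
    then show "eventually (\<lambda>u. dist (runmax b u) (runmax b t) < e) (at_right t)"
      using d(1) unfolding eventually_at_right_field by (intro exI[of _ "t + d"]) auto
  qed
  with t show ?thesis by (simp add: continuous_within)
qed

end

section \<open>Sampling a continuous path on the grid\<close>

lemma psum_incr: "psum (incr b m) n = b (real n / real m) - b 0"
  by (induction n) (auto simp: psum_def incr_def)

lemma floor_div_le:
  assumes "0 \<le> t" shows "real (nat \<lfloor>real m * t\<rfloor>) / real m \<le> t"
proof (cases "m = 0")
  case False
  have "real (nat \<lfloor>real m * t\<rfloor>) \<le> real m * t" using assms by simp
  with False show ?thesis by (simp add: divide_le_eq mult.commute)
qed (use assms in simp)

lemma floor_div_ge: "t - 1 / real (Suc j) \<le> real (nat \<lfloor>real (Suc j) * t\<rfloor>) / real (Suc j)"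
proof -
  have "real (Suc j) * t - 1 \<le> real (nat \<lfloor>real (Suc j) * t\<rfloor>)"
    by linarith
  then have "(real (Suc j) * t - 1) / real (Suc j) \<le> real (nat \<lfloor>real (Suc j) * t\<rfloor>) / real (Suc j)"
    by (rule divide_right_mono) simp
  then show ?thesis by (simp only: diff_divide_distrib) simp
qed

text \<open>The grid time lags behind \<open>t\<close> by at most 1 whatever the mesh, so moving to
  it costs at most a factor \<open>exp c\<close>. This makes the later bounds uniform in
  \<open>j\<close>.\<close>

lemma exp_floor_le:
  assumes "0 \<le> c"
  shows "- c * (real (nat \<lfloor>real (Suc j) * t\<rfloor>) / real (Suc j)) \<le> c - c * t"
proof -
  have "t - 1 \<le> t - 1 / real (Suc j)" by simp
  also have "\<dots> \<le> real (nat \<lfloor>real (Suc j) * t\<rfloor>) / real (Suc j)" by (rule floor_div_ge)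
  finally have "c * (t - 1) \<le> c * (real (nat \<lfloor>real (Suc j) * t\<rfloor>) / real (Suc j))"
    using assms by (rule mult_left_mono)
  then show ?thesis by (simp add: algebra_simps)
qed

lemma floor_div_tendsto:
  assumes "0 \<le> t"
  shows "(\<lambda>m. real (nat \<lfloor>real (Suc m) * t\<rfloor>) / real (Suc m)) \<longlonglongrightarrow> t"
proof (rule tendsto_sandwich[of "\<lambda>m. t - 1 / real (Suc m)" _ _ "\<lambda>_. t"])
  show "\<forall>\<^sub>F m in sequentially. t - 1 / real (Suc m) \<le> real (nat \<lfloor>real (Suc m) * t\<rfloor>) / real (Suc m)"
    by (intro always_eventually allI floor_div_ge)
  show "\<forall>\<^sub>F m in sequentially. real (nat \<lfloor>real (Suc m) * t\<rfloor>) / real (Suc m) \<le> t"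
    by (intro always_eventually allI floor_div_le assms)
  show "(\<lambda>m. t - 1 / real (Suc m)) \<longlonglongrightarrow> t"
    using tendsto_diff[OF tendsto_const LIMSEQ_inverse_real_of_nat, of t] by (simp add: divide_inverse)
qed auto

lemma path_sample_tendsto:
  assumes "continuous_on {0..} b" "0 \<le> t"
  shows "(\<lambda>m. b (real (nat \<lfloor>real (Suc m) * t\<rfloor>) / real (Suc m))) \<longlonglongrightarrow> b t"
  using assms by (intro continuous_on_tendsto_compose[OF assms(1) floor_div_tendsto]) auto

lemma pmax_incr_le_runmax:
  assumes "continuous_on {0..} b" "b 0 = 0" "0 \<le> t"
  shows "pmax (incr b m) (nat \<lfloor>real m * t\<rfloor>) \<le> runmax b t"
proof -
  obtain j where j: "j \<le> nat \<lfloor>real m * t\<rfloor>" "pmax (incr b m) (nat \<lfloor>real m * t\<rfloor>) = psum (incr b m) j"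
    using pmax_attained by blast
  have "real j / real m \<le> real (nat \<lfloor>real m * t\<rfloor>) / real m"
    using j by (intro divide_right_mono) auto
  also have "\<dots> \<le> t" by (rule floor_div_le) fact
  finally show ?thesis
    using j assms by (auto simp: psum_incr intro!: runmax_ge)
qed

text \<open>The grid maximum is squeezed between the running maximum and the path value at the grid
  point just below a maximizer \<open>s\<close>.\<close>

lemma pmax_incr_tendsto_runmax:
  assumes b: "continuous_on {0..} b" "b 0 = 0" and t: "0 \<le> t"
  shows "(\<lambda>m. pmax (incr b (Suc m)) (nat \<lfloor>real (Suc m) * t\<rfloor>)) \<longlonglongrightarrow> runmax b t"
proof -
  obtain s where s: "s \<in> {0..t}" "runmax b t = b s"
    using runmax_attained[OF b(1) t] by blast
  show ?thesis
  proof (rule tendsto_sandwich[of "\<lambda>m. b (real (nat \<lfloor>real (Suc m) * s\<rfloor>) / real (Suc m))" _ _ "\<lambda>_. runmax b t"])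
    show "(\<lambda>m. b (real (nat \<lfloor>real (Suc m) * s\<rfloor>) / real (Suc m))) \<longlonglongrightarrow> runmax b t"
      using path_sample_tendsto[OF b(1)] s by auto
    show "\<forall>\<^sub>F m in sequentially. b (real (nat \<lfloor>real (Suc m) * s\<rfloor>) / real (Suc m))
        \<le> pmax (incr b (Suc m)) (nat \<lfloor>real (Suc m) * t\<rfloor>)"
    proof (intro always_eventually allI)
      fix m
      have "nat \<lfloor>real (Suc m) * s\<rfloor> \<le> nat \<lfloor>real (Suc m) * t\<rfloor>"
        using s by (intro nat_mono floor_mono mult_left_mono) auto
      from pmax_ge[OF this, of "incr b (Suc m)"]
      show "b (real (nat \<lfloor>real (Suc m) * s\<rfloor>) / real (Suc m)) \<le> pmax (incr b (Suc m)) (nat \<lfloor>real (Suc m) * t\<rfloor>)"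
        unfolding psum_incr using b(2) by simp
    qed
    show "\<forall>\<^sub>F m in sequentially. pmax (incr b (Suc m)) (nat \<lfloor>real (Suc m) * t\<rfloor>) \<le> runmax b t"
      by (intro always_eventually allI pmax_incr_le_runmax b t)
  qed auto
qed

section \<open>Discounted integrals and the Gaussian exponential moment\<close>

lemma nn_integral_floor:
  fixes c :: "nat \<Rightarrow> ennreal"
  assumes m: "0 < m"
  shows "(\<integral>\<^sup>+t. c (nat \<lfloor>real m * t\<rfloor>) * indicator {0..} t \<partial>lborel) = ennreal (1 / real m) * (\<Sum>n. c n)"
proof -
  let ?I = "\<lambda>n. {real n / real m ..< real (Suc n) / real m}"
  have I: "t \<in> ?I n \<longleftrightarrow> 0 \<le> t \<and> n = nat \<lfloor>real m * t\<rfloor>" for t n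
  proof -
    have "t \<in> ?I n \<longleftrightarrow> real n \<le> real m * t \<and> real m * t < real n + 1"
      using m by (simp add: divide_le_eq less_divide_eq mult.commute add.commute)
    also have "\<dots> \<longleftrightarrow> \<lfloor>real m * t\<rfloor> = int n"
      by (simp add: floor_eq_iff)
    also have "\<dots> \<longleftrightarrow> 0 \<le> t \<and> n = nat \<lfloor>real m * t\<rfloor>"
    proof
      assume *: "\<lfloor>real m * t\<rfloor> = int n"
      then have "0 \<le> real m * t" by linarith
      then show "0 \<le> t \<and> n = nat \<lfloor>real m * t\<rfloor>" using m * by (simp add: zero_le_mult_iff)
    qed simp
    finally show ?thesis .
  qed
  have "(\<Sum>n. c n * indicator (?I n) t) = c (nat \<lfloor>real m * t\<rfloor>) * indicator {0..} t" for t
  proof -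
    have "(\<Sum>n. c n * indicator (?I n) t) = (\<Sum>n\<in>{nat \<lfloor>real m * t\<rfloor>}. c n * indicator (?I n) t)"
      by (rule suminf_finite) (auto simp: indicator_def I simp del: atLeastLessThan_iff of_nat_Suc)
    also have "\<dots> = c (nat \<lfloor>real m * t\<rfloor>) * indicator {0..} t"
      by (auto simp: indicator_def I simp del: atLeastLessThan_iff of_nat_Suc)
    finally show ?thesis .
  qed
  then have "(\<integral>\<^sup>+t. c (nat \<lfloor>real m * t\<rfloor>) * indicator {0..} t \<partial>lborel) =
      (\<integral>\<^sup>+t. (\<Sum>n. c n * indicator (?I n) t) \<partial>lborel)" by simp
  also have "\<dots> = (\<Sum>n. \<integral>\<^sup>+t. c n * indicator (?I n) t \<partial>lborel)"
    by (rule nn_integral_suminf) auto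
  also have "\<dots> = (\<Sum>n. ennreal (1 / real m) * c n)"
  proof (rule suminf_cong)
    fix n
    have "real (Suc n) / real m - real n / real m = 1 / real m"
      by (simp flip: diff_divide_distrib)
    then have "emeasure lborel (?I n) = ennreal (1 / real m)"
      by (subst emeasure_lborel_Ico) (auto intro!: divide_right_mono)
    then show "(\<integral>\<^sup>+t. c n * indicator (?I n) t \<partial>lborel) = ennreal (1 / real m) * c n"
      by (subst nn_integral_cmult_indicator) (auto simp: mult.commute)
  qed
  finally show ?thesis by simp
qed

lemma nn_integral_exp_tail:
  assumes "0 < r"
  shows "(\<integral>\<^sup>+s. ennreal (r * exp (- r * s)) * indicator {t..} s \<partial>lborel) = ennreal (exp (- r * t))"
proof -
  have "((\<lambda>s. exp (- r * s)) \<longlongrightarrow> 0) at_top"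
    using assms
    by (intro filterlim_compose[OF exp_at_bot] filterlim_tendsto_neg_mult_at_bot[OF tendsto_const] filterlim_ident) auto
  then have lim: "((\<lambda>s. - exp (- r * s)) \<longlongrightarrow> 0) at_top"
    using tendsto_minus by fastforce
  have "(\<integral>\<^sup>+s. ennreal (r * exp (- r * s)) * indicator {t..} s \<partial>lborel) = ennreal (0 - (- exp (- r * t)))"
    using assms lim
    by (intro nn_integral_FTC_atLeast) (auto intro!: derivative_eq_intros)
  then show ?thesis by simp
qed

lemma nn_integral_exp_discount:
  assumes "0 < c"
  shows "(\<integral>\<^sup>+t. ennreal (exp (- c * t)) * indicator {0..} t \<partial>lborel) = ennreal (1 / c)"
proof -
  have "(\<integral>\<^sup>+t. ennreal (exp (- c * t)) * indicator {0..} t \<partial>lborel) =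
      (\<integral>\<^sup>+t. ennreal (1 / c) * (ennreal (c * exp (- c * t)) * indicator {0..} t) \<partial>lborel)"
    using assms by (intro nn_integral_cong) (auto simp: indicator_def ennreal_mult'[symmetric])
  also have "\<dots> = ennreal (1 / c) * (\<integral>\<^sup>+t. ennreal (c * exp (- c * t)) * indicator {0..} t \<partial>lborel)"
    by (rule nn_integral_cmult) simp
  also have "\<dots> = ennreal (1 / c)"
    by (subst nn_integral_exp_tail[OF assms]) simp
  finally show ?thesis .
qed

text \<open>Integration by parts through Tonelli: the discount factor at t is the integral of r exp
  (- r s) over s \<ge> t, and the integrator gives [0, s] the mass \<open>\<theta> s\<close>,
  initial jump included. The public cost thereby becomes a time integral comparable with the private
  one.\<close>

lemma stieltjes_exp_discount:
  assumes r: "0 < r"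
    and nonneg: "\<And>t. 0 \<le> t \<Longrightarrow> 0 \<le> \<theta> t"
    and mono: "\<And>s t. 0 \<le> s \<Longrightarrow> s \<le> t \<Longrightarrow> \<theta> s \<le> \<theta> t"
    and rc: "\<And>t. 0 \<le> t \<Longrightarrow> continuous (at_right t) \<theta>"
  shows "stieltjes (\<lambda>t. exp (- r * t)) \<theta> = ennreal r * time_integral (\<lambda>t. exp (- r * t) * \<theta> t)"
proof -
  define F where "F t = (if t < 0 then 0 else \<theta> t)" for t
  define \<mu> where "\<mu> = interval_measure F"
  have F_mono: "F x \<le> F y" if "x \<le> y" for x y
    using that nonneg mono by (auto simp: F_def)
  have F_rc: "continuous (at_right x) F" for x
  proof (cases "x < 0")
    case True
    have "\<forall>\<^sub>F y in at_right x. F y = 0"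
      unfolding eventually_at_right_field using True by (intro exI[of _ 0]) (auto simp: F_def)
    then have "(F \<longlongrightarrow> 0) (at_right x)" by (rule tendsto_eventually)
    then show ?thesis using True by (simp add: continuous_within F_def)
  next
    case False
    have "\<forall>\<^sub>F y in at_right x. \<theta> y = F y"
      unfolding eventually_at_right_field using False by (intro exI[of _ "x + 1"]) (auto simp: F_def)
    moreover have "(\<theta> \<longlongrightarrow> F x) (at_right x)"
      using rc[of x] False by (simp add: continuous_within F_def)
    ultimately have "(F \<longlongrightarrow> F x) (at_right x)" by (rule Lim_transform_eventually[rotated])
    then show ?thesis by (simp add: continuous_within)
  qed
  interpret \<mu>: sigma_finite_measure \<mu>
    unfolding \<mu>_def by (rule sigma_finite_interval_measure) (use F_mono F_rc in auto)
  have sets_\<mu> [measurable_cong]: "sets \<mu> = sets borel" by (simp add: \<mu>_def)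
  interpret pair: pair_sigma_finite \<mu> lborel ..
  have Ioc: "emeasure \<mu> {a<..c} = F c - F a" if "a \<le> c" for a c
    unfolding \<mu>_def using that F_mono F_rc by (intro emeasure_interval_measure_Ioc) auto
  \<comment> \<open>The measure is known on half-open intervals. Since the open interval from -1 to
    0 is null, the closed interval from 0 to \<open>s\<close>, with its atom at 0, has the same mass
    as the half-open one from -1 to \<open>s\<close>.\<close>
  have "(\<Union>k::nat. {-1<..- 1 / real (Suc k)}) = {-1<..<0}"
  proof (intro equalityI subsetI)
    fix x :: real assume x: "x \<in> {-1<..<0}"
    then obtain k :: nat where "1 / real (Suc k) < - x" using nat_approx_posE[of "- x"] by auto
    then show "x \<in> (\<Union>k::nat. {-1<..- 1 / real (Suc k)})" using x by (auto intro!: exI[of _ k])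
  next
    fix x :: real assume "x \<in> (\<Union>k::nat. {-1<..- 1 / real (Suc k)})"
    then obtain k :: nat where k: "-1 < x" "x \<le> - 1 / real (Suc k)" by auto
    have "- 1 / real (Suc k) < 0" by simp
    with k show "x \<in> {-1<..<0}" by (auto intro: le_less_trans)
  qed
  moreover have "(\<Union>k::nat. {-1<..- 1 / real (Suc k)}) \<in> null_sets \<mu>"
    by (intro null_sets_UN null_setsI) (auto simp: Ioc F_def)
  ultimately have null: "{-1<..<0} \<in> null_sets \<mu>" by simp
  have Icc: "emeasure \<mu> {0..s} = ennreal (\<theta> s)" if "0 \<le> s" for s
  proof -
    have "{-1<..s} = {-1<..<0} \<union> {0..s}" using that by auto
    moreover have "emeasure \<mu> {-1<..s} = ennreal (\<theta> s)" using that by (simp add: Ioc F_def)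
    ultimately show ?thesis using null by (simp add: emeasure_Un_null_set Un_commute sets_\<mu>)
  qed
  define K where "K = {z :: real \<times> real. 0 \<le> fst z \<and> fst z \<le> snd z}"
  have "closed K"
    unfolding K_def by (intro closed_Collect_conj closed_Collect_le continuous_intros)
  then have "K \<in> sets (borel \<Otimes>\<^sub>M borel)"
    unfolding borel_prod by simp
  also have "sets (borel \<Otimes>\<^sub>M borel) = sets (\<mu> \<Otimes>\<^sub>M lborel)"
    by (intro sets_pair_measure_cong) (auto simp: sets_\<mu>)
  finally have K: "K \<in> sets (\<mu> \<Otimes>\<^sub>M lborel)" .
  have "stieltjes (\<lambda>t. exp (- r * t)) \<theta> = (\<integral>\<^sup>+t. ennreal (exp (- r * t)) * indicator {0..} t \<partial>\<mu>)"
    by (simp add: stieltjes_def \<mu>_def F_def[abs_def])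
  also have "\<dots> = (\<integral>\<^sup>+t. \<integral>\<^sup>+s. ennreal (r * exp (- r * s)) * indicator {t..} s * indicator {0..} t \<partial>lborel \<partial>\<mu>)"
    by (subst nn_integral_multc) (measurable, simp only: nn_integral_exp_tail[OF r])
  also have "\<dots> = (\<integral>\<^sup>+t. \<integral>\<^sup>+s. ennreal (r * exp (- r * s)) * indicator {0..} s * indicator K (t, s) \<partial>lborel \<partial>\<mu>)"
    by (intro nn_integral_cong) (auto simp: indicator_def K_def)
  also have "\<dots> = (\<integral>\<^sup>+s. \<integral>\<^sup>+t. ennreal (r * exp (- r * s)) * indicator {0..} s * indicator K (t, s) \<partial>\<mu> \<partial>lborel)"
  proof (rule pair.Fubini'[symmetric])
    have "(\<lambda>z. ennreal (r * exp (- r * snd z)) * indicator {0..} (snd z) * indicator K z) \<in> borel_measurable (\<mu> \<Otimes>\<^sub>M lborel)"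
      using K by measurable
    then show "(\<lambda>(t, s). ennreal (r * exp (- r * s)) * indicator {0..} s * indicator K (t, s)) \<in> borel_measurable (\<mu> \<Otimes>\<^sub>M lborel)"
      by (simp add: case_prod_unfold)
  qed
  also have "\<dots> = (\<integral>\<^sup>+s. ennreal (r * exp (- r * s)) * indicator {0..} s * ennreal (\<theta> s) \<partial>lborel)"
  proof (rule nn_integral_cong)
    fix s :: real
    have "(\<integral>\<^sup>+t. ennreal (r * exp (- r * s)) * indicator {0..} s * indicator K (t, s) \<partial>\<mu>) =
       (\<integral>\<^sup>+t. ennreal (r * exp (- r * s)) * indicator {0..} s * indicator {0..s} t \<partial>\<mu>)"
      by (intro nn_integral_cong) (auto simp: indicator_def K_def)
    also have "\<dots> = ennreal (r * exp (- r * s)) * indicator {0..} s * emeasure \<mu> {0..s}"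
      by (subst nn_integral_cmult_indicator) (auto simp: sets_\<mu>)
    also have "\<dots> = ennreal (r * exp (- r * s)) * indicator {0..} s * ennreal (\<theta> s)"
      by (cases "0 \<le> s") (auto simp: Icc)
    finally show "(\<integral>\<^sup>+t. ennreal (r * exp (- r * s)) * indicator {0..} s * indicator K (t, s) \<partial>\<mu>) =
       ennreal (r * exp (- r * s)) * indicator {0..} s * ennreal (\<theta> s)" .
  qed
  also have "\<dots> = (\<integral>\<^sup>+s. ennreal r * (ennreal (exp (- r * s) * \<theta> s) * indicator {0..} s) \<partial>lborel)"
    using r nonneg by (intro nn_integral_cong) (auto simp: indicator_def ennreal_mult mult_ac)
  also have "\<dots> = ennreal r * time_integral (\<lambda>t. exp (- r * t) * \<theta> t)"
  proof -
    \<comment> \<open>\<open>\<theta>\<close> is constrained for nonnegative times only; its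
      extension \<open>F\<close> is monotone on the whole line and therefore Borel.\<close>
    have [measurable]: "F \<in> borel_measurable borel"
      by (rule borel_measurable_mono) (simp add: mono_def F_mono)
    have "time_integral (\<lambda>t. exp (- r * t) * \<theta> t) = time_integral (\<lambda>t. exp (- r * t) * F t)"
      unfolding time_integral_def by (intro nn_integral_cong) (auto simp: indicator_def F_def)
    moreover have "(\<integral>\<^sup>+s. ennreal r * (ennreal (exp (- r * s) * \<theta> s) * indicator {0..} s) \<partial>lborel) =
       (\<integral>\<^sup>+s. ennreal r * (ennreal (exp (- r * s) * F s) * indicator {0..} s) \<partial>lborel)"
      by (intro nn_integral_cong) (auto simp: indicator_def F_def)
    ultimately show ?thesis
      unfolding time_integral_def by (simp add: nn_integral_cmult)
  qed
  finally show ?thesis .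
qed

text \<open>Completing the square shifts the mean to \<open>l * \<sigma>\<^sup>2\<close>.\<close>

lemma normal_mgf:
  assumes "0 < \<sigma>"
  shows "(\<integral>\<^sup>+x. ennreal (normal_density 0 \<sigma> x) * ennreal (exp (l * x)) \<partial>lborel) = ennreal (exp (l\<^sup>2 * \<sigma>\<^sup>2 / 2))"
proof -
  have *: "normal_density 0 \<sigma> x * exp (l * x) = exp (l\<^sup>2 * \<sigma>\<^sup>2 / 2) * normal_density (l * \<sigma>\<^sup>2) \<sigma> x" for x
  proof -
    have "- (x - 0)\<^sup>2 / (2 * \<sigma>\<^sup>2) + l * x = l\<^sup>2 * \<sigma>\<^sup>2 / 2 + - (x - l * \<sigma>\<^sup>2)\<^sup>2 / (2 * \<sigma>\<^sup>2)"
      using assms by (simp add: field_simps power2_eq_square)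
    then have "exp (- (x - 0)\<^sup>2 / (2 * \<sigma>\<^sup>2)) * exp (l * x) =
        exp (l\<^sup>2 * \<sigma>\<^sup>2 / 2) * exp (- (x - l * \<sigma>\<^sup>2)\<^sup>2 / (2 * \<sigma>\<^sup>2))"
      by (simp only: exp_add[symmetric])
    then show ?thesis by (simp add: normal_density_def)
  qed
  have "(\<integral>\<^sup>+x. ennreal (normal_density 0 \<sigma> x) * ennreal (exp (l * x)) \<partial>lborel) =
     (\<integral>\<^sup>+x. ennreal (exp (l\<^sup>2 * \<sigma>\<^sup>2 / 2)) * ennreal (normal_density (l * \<sigma>\<^sup>2) \<sigma> x) \<partial>lborel)"
    by (simp only: ennreal_mult'[symmetric] normal_density_nonneg exp_ge_zero *)
  also have "\<dots> = ennreal (exp (l\<^sup>2 * \<sigma>\<^sup>2 / 2)) * (\<integral>\<^sup>+x. ennreal (normal_density (l * \<sigma>\<^sup>2) \<sigma> x) \<partial>lborel)"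
    by (rule nn_integral_cmult) auto
  also have "(\<integral>\<^sup>+x. ennreal (normal_density (l * \<sigma>\<^sup>2) \<sigma> x) \<partial>lborel) = 1"
    using assms by (subst nn_integral_eq_integral) auto
  finally show ?thesis by simp
qed

section \<open>Passage to continuous time\<close>

text \<open>Continuity and the start at 0 are imposed at every point, not almost surely, so that
  pathwise lemmas apply without exceptional sets; \<open>brownian_motion_continuous_version\<close>
  supplies such a version.\<close>

locale continuous_process = prob_space M for M :: "'a measure" +
  fixes B :: "real \<Rightarrow> 'a \<Rightarrow> real" and r :: real
  assumes measurable_path: "\<And>t. 0 \<le> t \<Longrightarrow> B t \<in> borel_measurable M"
    and continuous_path: "\<And>\<omega>. \<omega> \<in> space M \<Longrightarrow> continuous_on {0..} (\<lambda>t. B t \<omega>)"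
    and path_0: "\<And>\<omega>. \<omega> \<in> space M \<Longrightarrow> B 0 \<omega> = 0"
    and r_pos: "0 < r"
begin

sublocale time_space: pair_sigma_finite "lborel :: real measure" M ..

abbreviation time_path_space :: "(real \<times> 'a) measure" where
  "time_path_space \<equiv> lborel \<Otimes>\<^sub>M M"

definition grid_max :: "nat \<Rightarrow> nat \<Rightarrow> 'a \<Rightarrow> real" where
  "grid_max m k \<omega> = pmax (incr (\<lambda>t. B t \<omega>) m) k"

definition path_max :: "real \<Rightarrow> 'a \<Rightarrow> real" where
  "path_max t \<omega> = runmax (\<lambda>t. B t \<omega>) t"

definition grid_term :: "real \<Rightarrow> real \<Rightarrow> nat \<Rightarrow> nat \<Rightarrow> 'a \<Rightarrow> real" where
  "grid_term l \<mu> m k \<omega> = exp (- r * (real k / real m) + l * grid_max m k \<omega>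
     - \<mu> * (grid_max m k \<omega> - B (real k / real m) \<omega>))"

definition sampled :: "real \<Rightarrow> real \<Rightarrow> nat \<Rightarrow> real \<times> 'a \<Rightarrow> real" where
  "sampled l \<mu> m = (\<lambda>(t, \<omega>). indicator {0..} t * grid_term l \<mu> m (nat \<lfloor>real m * t\<rfloor>) \<omega>)"

definition limiting :: "real \<Rightarrow> real \<Rightarrow> real \<times> 'a \<Rightarrow> real" where
  "limiting l \<mu> = (\<lambda>(t, \<omega>). indicator {0..} t *
     exp (- r * t + l * path_max t \<omega> - \<mu> * (path_max t \<omega> - B t \<omega>)))"

definition sampled_value :: "real \<Rightarrow> real \<Rightarrow> nat \<Rightarrow> ennreal" where
  "sampled_value l \<mu> m = (\<integral>\<^sup>+z. ennreal (sampled l \<mu> m z) \<partial>time_path_space)"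

definition limit_value :: "real \<Rightarrow> real \<Rightarrow> ennreal" where
  "limit_value l \<mu> = (\<integral>\<^sup>+z. ennreal (limiting l \<mu> z) \<partial>time_path_space)"

lemma measurable_incr: "(\<lambda>\<omega>. incr (\<lambda>t. B t \<omega>) m i) \<in> borel_measurable M"
  unfolding incr_def by (intro borel_measurable_diff measurable_path) auto

lemma measurable_psum_incr: "(\<lambda>\<omega>. psum (incr (\<lambda>t. B t \<omega>) m) k) \<in> borel_measurable M"
  unfolding psum_def by (intro borel_measurable_sum measurable_incr)

lemma measurable_grid_max [measurable]: "grid_max m k \<in> borel_measurable M"
  unfolding grid_max_def[abs_def] pmax_def
  by (intro borel_measurable_Max measurable_psum_incr) auto

lemma measurable_grid_term [measurable]: "grid_term l \<mu> m k \<in> borel_measurable M"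
proof -
  have [measurable]: "B (real k / real m) \<in> borel_measurable M"
    by (intro measurable_path) auto
  show ?thesis unfolding grid_term_def[abs_def] by measurable
qed

text \<open>Inside \<open>grid_term\<close> time enters through a floor with countably many values,
  so measurability for each fixed grid index suffices.\<close>

lemma measurable_sampled [measurable]: "sampled l \<mu> m \<in> borel_measurable time_path_space"
proof -
  have "(\<lambda>z. grid_term l \<mu> m (nat \<lfloor>real m * fst z\<rfloor>) (snd z)) \<in> borel_measurable time_path_space"
  proof (rule measurable_compose_countable)
    show "(\<lambda>z. nat \<lfloor>real m * fst z\<rfloor>) \<in> time_path_space \<rightarrow>\<^sub>M count_space UNIV"
      by measurable
  qed measurable
  then show ?thesis
    unfolding sampled_def by (simp add: case_prod_unfold)
qed

lemma path_max_ge: "\<omega> \<in> space M \<Longrightarrow> 0 \<le> t \<Longrightarrow> B t \<omega> \<le> path_max t \<omega>"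
  unfolding path_max_def by (rule runmax_ge[OF continuous_path]) auto

lemma grid_max_nonneg: "0 \<le> grid_max m k \<omega>"
  by (simp add: grid_max_def pmax_nonneg)

lemma grid_max_ge: "\<omega> \<in> space M \<Longrightarrow> B (real k / real m) \<omega> \<le> grid_max m k \<omega>"
  using pmax_ge[of k k "incr (\<lambda>t. B t \<omega>) m"] path_0 by (simp add: psum_incr grid_max_def)

lemma grid_max_le_path_max:
  "\<omega> \<in> space M \<Longrightarrow> 0 \<le> t \<Longrightarrow> grid_max m (nat \<lfloor>real m * t\<rfloor>) \<omega> \<le> path_max t \<omega>"
  unfolding grid_max_def path_max_def by (intro pmax_incr_le_runmax continuous_path path_0)

lemma sampled_tendsto:
  assumes "z \<in> space time_path_space"
  shows "(\<lambda>j. sampled l \<mu> (Suc j) z) \<longlonglongrightarrow> limiting l \<mu> z"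
proof -
  obtain t \<omega> where z: "z = (t, \<omega>)" "\<omega> \<in> space M"
    using assms by (cases z) (auto simp: space_pair_measure)
  show ?thesis
  proof (cases "0 \<le> t")
    case True
    show ?thesis
      unfolding z sampled_def limiting_def grid_term_def grid_max_def path_max_def prod.case
      using True z
      by (intro tendsto_intros pmax_incr_tendsto_runmax floor_div_tendsto path_0
          path_sample_tendsto[of "\<lambda>t. B t \<omega>"] continuous_path) auto
  qed (simp add: z sampled_def limiting_def)
qed

text \<open>Joint measurability in time and path is inherited from the sampled processes by a
  pointwise limit.\<close>

lemma measurable_limiting [measurable]: "limiting l \<mu> \<in> borel_measurable time_path_space"
  by (rule borel_measurable_LIMSEQ_metric[OF _ sampled_tendsto]) measurable

text \<open>Fatou's lemma, available before any finiteness is known: it turns bounds along the grids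
  into finiteness of the limit.\<close>

lemma limit_value_le_liminf: "limit_value l \<mu> \<le> liminf (\<lambda>j. sampled_value l \<mu> (Suc j))"
proof -
  have "limit_value l \<mu> = (\<integral>\<^sup>+z. liminf (\<lambda>j. ennreal (sampled l \<mu> (Suc j) z)) \<partial>time_path_space)"
    unfolding limit_value_def
  proof (rule nn_integral_cong)
    fix z assume "z \<in> space time_path_space"
    then have "(\<lambda>j. ennreal (sampled l \<mu> (Suc j) z)) \<longlonglongrightarrow> ennreal (limiting l \<mu> z)"
      by (intro tendsto_ennrealI sampled_tendsto)
    then show "ennreal (limiting l \<mu> z) = liminf (\<lambda>j. ennreal (sampled l \<mu> (Suc j) z))"
      by (simp add: lim_imp_Liminf)
  qed
  also have "\<dots> \<le> liminf (\<lambda>j. sampled_value l \<mu> (Suc j))"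
    unfolding sampled_value_def by (rule nn_integral_liminf) measurable
  finally show ?thesis .
qed

text \<open>Dominated convergence for both signs of \<open>l\<close>. If \<open>l \<le> 0\<close>
  the bound reduces to \<open>limit_value 0 0\<close>; otherwise it is the exponential moment of the
  running maximum. The factor \<open>exp r\<close> pays for rounding time down to the grid.\<close>

lemma sampled_value_tendsto:
  assumes fin: "limit_value (max l 0) 0 < \<infinity>" and \<mu>: "0 \<le> \<mu>"
  shows "(\<lambda>j. sampled_value l \<mu> (Suc j)) \<longlonglongrightarrow> limit_value l \<mu>"
  unfolding sampled_value_def limit_value_def
proof (rule nn_integral_dominated_convergence[where w = "\<lambda>z. ennreal (exp r) * ennreal (limiting (max l 0) 0 z)"])
  show "(\<integral>\<^sup>+z. ennreal (exp r) * ennreal (limiting (max l 0) 0 z) \<partial>time_path_space) < \<infinity>"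
    using fin by (subst nn_integral_cmult) (auto simp: limit_value_def ennreal_mult_less_top)
  show "AE z in time_path_space. ennreal (sampled l \<mu> (Suc j) z) \<le> ennreal (exp r) * ennreal (limiting (max l 0) 0 z)" for j
  proof (rule AE_I2)
    fix z assume "z \<in> space time_path_space"
    then obtain t \<omega> where z: "z = (t, \<omega>)" and \<omega>: "\<omega> \<in> space M"
      by (cases z) (auto simp: space_pair_measure)
    show "ennreal (sampled l \<mu> (Suc j) z) \<le> ennreal (exp r) * ennreal (limiting (max l 0) 0 z)"
    proof (cases "0 \<le> t")
      case True
      define k where "k = nat \<lfloor>real (Suc j) * t\<rfloor>"
      have "l * grid_max (Suc j) k \<omega> \<le> max l 0 * grid_max (Suc j) k \<omega>"
        by (intro mult_right_mono grid_max_nonneg) auto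
      also have "\<dots> \<le> max l 0 * path_max t \<omega>"
        unfolding k_def by (intro mult_left_mono grid_max_le_path_max \<omega> True) auto
      finally have 1: "l * grid_max (Suc j) k \<omega> \<le> max l 0 * path_max t \<omega>" .
      have 2: "0 \<le> \<mu> * (grid_max (Suc j) k \<omega> - B (real k / real (Suc j)) \<omega>)"
        using \<mu> grid_max_ge[OF \<omega>] by (intro mult_nonneg_nonneg) (auto simp del: of_nat_Suc)
      have 3: "- r * (real k / real (Suc j)) \<le> r - r * t"
        unfolding k_def by (rule exp_floor_le) (use r_pos in simp)
      have "sampled l \<mu> (Suc j) z \<le> exp (r + (- r * t + max l 0 * path_max t \<omega>))"
        using True 1 2 3 unfolding z sampled_def grid_term_def prod.case k_def[symmetric]
        by (simp del: of_nat_Suc)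
      also have "\<dots> = exp r * limiting (max l 0) 0 z"
        using True by (simp add: z limiting_def exp_add)
      finally show ?thesis by (simp add: ennreal_mult'[symmetric] ennreal_leI)
    qed (simp add: z sampled_def)
  qed
  show "AE z in time_path_space. (\<lambda>j. ennreal (sampled l \<mu> (Suc j) z)) \<longlonglongrightarrow> ennreal (limiting l \<mu> z)"
    by (intro AE_I2 tendsto_ennrealI sampled_tendsto)
qed measurable

section \<open>Basic properties of the discounted values\<close>

lemma limit_value_0_0: "limit_value 0 0 = ennreal (1 / r)"
proof -
  have "limit_value 0 0 = (\<integral>\<^sup>+t. \<integral>\<^sup>+\<omega>. ennreal (limiting 0 0 (t, \<omega>)) \<partial>M \<partial>lborel)"
    unfolding limit_value_def by (rule nn_integral_fst[symmetric]) measurable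
  also have "\<dots> = (\<integral>\<^sup>+t. ennreal (exp (- r * t)) * indicator {0..} t \<partial>lborel)"
    by (intro nn_integral_cong) (auto simp: limiting_def emeasure_space_1 indicator_def)
  finally show ?thesis by (simp only: nn_integral_exp_discount[OF r_pos])
qed

text \<open>The integrand is an exponential on a set of positive measure. Positivity rules out the
  form 0 times infinity in limits of products and supplies the lower bound in
  \<open>limit_value_finite\<close>.\<close>

lemma limit_value_pos: "0 < limit_value l \<mu>"
proof (rule ccontr)
  assume "\<not> 0 < limit_value l \<mu>"
  then have "(\<integral>\<^sup>+z. ennreal (limiting l \<mu> z) \<partial>time_path_space) = 0"
    by (simp add: limit_value_def)
  then have "AE z in time_path_space. ennreal (limiting l \<mu> z) = 0"
    by (subst (asm) nn_integral_0_iff_AE) auto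
  moreover have "ennreal (limiting l \<mu> z) = 0 \<Longrightarrow> z \<notin> {0..} \<times> space M" for z
    by (auto simp: limiting_def)
  ultimately have "AE z in time_path_space. z \<notin> {0..} \<times> space M"
    by (rule eventually_mono)
  then have "emeasure time_path_space ({0..} \<times> space M) = 0"
    by (subst (asm) AE_iff_measurable[of "{0..} \<times> space M"]) (auto simp: space_pair_measure)
  moreover have "emeasure time_path_space ({0..} \<times> space M) = emeasure lborel {0::real..} * 1"
    by (subst emeasure_pair_measure_Times) (auto simp: emeasure_space_1)
  moreover have "emeasure lborel {0::real..} \<ge> emeasure lborel {0..1::real}"
    by (rule emeasure_mono) auto
  ultimately show False by simp
qed

definition discounted :: "real \<Rightarrow> real \<Rightarrow> 'a \<Rightarrow> ennreal" where
  "discounted l \<mu> \<omega> =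
     time_integral (\<lambda>t. exp (- r * t + l * path_max t \<omega> - \<mu> * (path_max t \<omega> - B t \<omega>)))"

lemma discounted_eq: "discounted l \<mu> \<omega> = (\<integral>\<^sup>+t. ennreal (limiting l \<mu> (t, \<omega>)) \<partial>lborel)"
  unfolding discounted_def time_integral_def
  by (intro nn_integral_cong) (auto simp: limiting_def indicator_def)

lemma measurable_discounted [measurable]: "discounted l \<mu> \<in> borel_measurable M"
  unfolding discounted_eq[abs_def] by measurable

lemma nn_integral_discounted: "(\<integral>\<^sup>+\<omega>. discounted l \<mu> \<omega> \<partial>M) = limit_value l \<mu>"
  unfolding limit_value_def discounted_eq by (rule time_space.nn_integral_snd) measurable

lemma time_integral_cmult_discounted:
  assumes "\<omega> \<in> space M" "0 \<le> c"
    and f: "\<And>t. 0 \<le> t \<Longrightarrow> f t = c * exp (- r * t + l * path_max t \<omega> - \<mu> * (path_max t \<omega> - B t \<omega>))"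
  shows "time_integral f = ennreal c * discounted l \<mu> \<omega>"
proof -
  have "time_integral f = (\<integral>\<^sup>+t. ennreal c * ennreal (limiting l \<mu> (t, \<omega>)) \<partial>lborel)"
    unfolding time_integral_def
    by (intro nn_integral_cong) (auto simp: limiting_def indicator_def f ennreal_mult'[symmetric] \<open>0 \<le> c\<close>)
  also have "\<dots> = ennreal c * discounted l \<mu> \<omega>"
    unfolding discounted_eq using assms(1) by (intro nn_integral_cmult) measurable
  finally show ?thesis .
qed

lemma sampled_value_eq_suminf:
  assumes "0 < m"
  shows "sampled_value l \<mu> m = ennreal (1 / real m) * (\<Sum>k. \<integral>\<^sup>+\<omega>. ennreal (grid_term l \<mu> m k \<omega>) \<partial>M)"
proof -
  have "sampled_value l \<mu> m = (\<integral>\<^sup>+t. \<integral>\<^sup>+\<omega>. ennreal (sampled l \<mu> m (t, \<omega>)) \<partial>M \<partial>lborel)"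
    unfolding sampled_value_def by (rule nn_integral_fst[symmetric]) measurable
  also have "\<dots> = (\<integral>\<^sup>+t. (\<integral>\<^sup>+\<omega>. ennreal (grid_term l \<mu> m (nat \<lfloor>real m * t\<rfloor>) \<omega>) \<partial>M) * indicator {0..} t \<partial>lborel)"
    by (intro nn_integral_cong) (auto simp: sampled_def indicator_def)
  also have "\<dots> = ennreal (1 / real m) * (\<Sum>k. \<integral>\<^sup>+\<omega>. ennreal (grid_term l \<mu> m k \<omega>) \<partial>M)"
    by (rule nn_integral_floor[OF assms])
  finally show ?thesis .
qed

end

text \<open>The law is recorded in the two forms that are used: iid increments on each grid for the
  factorization, and Gaussian marginals for the exponential moment.\<close>

locale continuous_brownian = continuous_process +
  assumes increments_law: "\<And>m. 0 < m \<Longrightarrow>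
      distr M (\<Pi>\<^sub>M i\<in>UNIV. borel) (\<lambda>\<omega>. incr (\<lambda>t. B t \<omega>) m) =
      (\<Pi>\<^sub>M i\<in>UNIV. density lborel (normal_density 0 (sqrt (1 / real m))))"
    and marginal_law: "\<And>t. 0 < t \<Longrightarrow> distributed M lborel (B t) (normal_density 0 (sqrt t))"
begin

text \<open>When \<open>B\<close> is a version of - W, \<open>opposite\<close> follows W itself. Its
  running maximum is the one produced by reversing the increments of \<open>B\<close> with a change
  of sign.\<close>

sublocale opposite: continuous_process M "\<lambda>t \<omega>. - B t \<omega>" r
  by unfold_locales (auto intro!: measurable_path continuous_path continuous_on_minus simp: path_0 r_pos)

abbreviation N :: "nat \<Rightarrow> real measure" where
  "N m \<equiv> density lborel (normal_density 0 (sqrt (1 / real m)))"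

lemma iid_walk_N: "0 < m \<Longrightarrow> iid_walk (N m)"
proof -
  assume "0 < m"
  then interpret N: prob_space "N m" by (intro prob_space_normal_density) simp
  interpret product_prob_space "\<lambda>_. N m" "UNIV :: nat set" by unfold_locales
  show ?thesis by unfold_locales simp
qed

lemma nn_integral_increments:
  assumes m: "0 < m" and f: "f \<in> borel_measurable (\<Pi>\<^sub>M i\<in>UNIV. N m)"
  shows "(\<integral>\<^sup>+\<omega>. f (incr (\<lambda>t. B t \<omega>) m) \<partial>M) = (\<integral>\<^sup>+x. f x \<partial>(\<Pi>\<^sub>M i\<in>UNIV. N m))"
proof -
  have sets_eq: "sets (\<Pi>\<^sub>M i\<in>UNIV. N m) = sets (\<Pi>\<^sub>M i\<in>(UNIV :: nat set). (borel :: real measure))"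
    by (intro sets_PiM_cong) auto
  have "(\<lambda>\<omega>. incr (\<lambda>t. B t \<omega>) m) \<in> measurable M (\<Pi>\<^sub>M i\<in>UNIV. borel)"
    by (rule measurable_PiM_single') (auto intro: measurable_incr)
  moreover have "f \<in> borel_measurable (\<Pi>\<^sub>M i\<in>UNIV. borel)"
    using f by (simp cong: measurable_cong_sets add: sets_eq)
  ultimately show ?thesis
    unfolding increments_law[OF m, symmetric] by (simp add: nn_integral_distr)
qed

text \<open>Discounting contributes the same factor in every step, so its power is the geometric
  weight of \<open>generating\<close>.\<close>

lemma nn_integral_grid_term:
  assumes m: "0 < m"
  shows "(\<integral>\<^sup>+\<omega>. ennreal (grid_term l \<mu> m k \<omega>) \<partial>M) =
    ennreal (exp (- r / real m)) ^ k *
    (\<integral>\<^sup>+x. ennreal (exp (l * pmax x k)) * ennreal (exp (- \<mu> * (pmax x k - psum x k))) \<partial>(\<Pi>\<^sub>M i\<in>UNIV. N m))"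
proof -
  interpret iid_walk "N m" by (rule iid_walk_N) fact
  let ?f = "\<lambda>x. ennreal (exp (l * pmax x k)) * ennreal (exp (- \<mu> * (pmax x k - psum x k)))"
  have "(\<integral>\<^sup>+\<omega>. ennreal (grid_term l \<mu> m k \<omega>) \<partial>M) =
     (\<integral>\<^sup>+\<omega>. ennreal (exp (- r / real m)) ^ k * ?f (incr (\<lambda>t. B t \<omega>) m) \<partial>M)"
  proof (rule nn_integral_cong)
    fix \<omega> assume "\<omega> \<in> space M"
    then have "grid_term l \<mu> m k \<omega> = exp (- r / real m) ^ k * (exp (l * pmax (incr (\<lambda>t. B t \<omega>) m) k) *
      exp (- \<mu> * (pmax (incr (\<lambda>t. B t \<omega>) m) k - psum (incr (\<lambda>t. B t \<omega>) m) k)))"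
      by (simp add: grid_term_def grid_max_def psum_incr path_0 exp_of_nat_mult[symmetric] exp_add[symmetric] algebra_simps)
    then show "ennreal (grid_term l \<mu> m k \<omega>) = ennreal (exp (- r / real m)) ^ k * ?f (incr (\<lambda>t. B t \<omega>) m)"
      by (simp only: ennreal_mult'[symmetric] ennreal_power exp_ge_zero zero_le_power)
  qed
  also have "\<dots> = (\<integral>\<^sup>+x. ennreal (exp (- r / real m)) ^ k * ?f x \<partial>S)"
    by (rule nn_integral_increments[OF m]) measurable
  also have "\<dots> = ennreal (exp (- r / real m)) ^ k * (\<integral>\<^sup>+x. ?f x \<partial>S)"
    by (rule nn_integral_cmult) measurable
  finally show ?thesis .
qed

lemma sampled_value_mult:
  assumes m: "0 < m"
  shows "sampled_value l \<mu> m * sampled_value 0 0 m = sampled_value l 0 m * sampled_value 0 \<mu> m"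
proof -
  interpret iid_walk "N m" by (rule iid_walk_N) fact
  have *: "sampled_value l \<mu> m = ennreal (1 / real m) *
      generating (ennreal (exp (- r / real m))) (\<lambda>x. ennreal (exp (l * x))) (\<lambda>x. ennreal (exp (- \<mu> * x)))" for l \<mu>
    by (simp only: sampled_value_eq_suminf[OF m] nn_integral_grid_term[OF m] generating_def)
  have "generating q (\<lambda>x. ennreal (exp (l * x))) (\<lambda>x. ennreal (exp (- \<mu> * x))) * generating q (\<lambda>_. 1) (\<lambda>_. 1) =
    generating q (\<lambda>x. ennreal (exp (l * x))) (\<lambda>_. 1) * generating q (\<lambda>_. 1) (\<lambda>x. ennreal (exp (- \<mu> * x)))" for q
    by (rule generating_mult) measurable
  then show ?thesis
    by (simp add: * mult_ac)
qed

text \<open>For parameter \<open>l = 0\<close> only the drop below the maximum is left. The reversal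
  identity applies at each fixed grid time, hence term by term in the series.\<close>

lemma sampled_value_reversal:
  assumes m: "0 < m"
  shows "sampled_value 0 \<mu> m = opposite.sampled_value (- \<mu>) 0 m"
proof -
  interpret iid_walk "N m" by (rule iid_walk_N) fact
  have "(\<integral>\<^sup>+\<omega>. ennreal (grid_term 0 \<mu> m k \<omega>) \<partial>M) = (\<integral>\<^sup>+\<omega>. ennreal (opposite.grid_term (- \<mu>) 0 m k \<omega>) \<partial>M)" for k
  proof -
    have neg [measurable]: "(\<lambda>x. pmax (\<lambda>i. - x i) k) \<in> borel_measurable S"
      unfolding pmax_def psum_def using measurable_coord by measurable
    have "(\<integral>\<^sup>+\<omega>. ennreal (grid_term 0 \<mu> m k \<omega>) \<partial>M) =
      ennreal (exp (- r / real m)) ^ k * (\<integral>\<^sup>+x. ennreal (exp (- \<mu> * (pmax x k - psum x k))) \<partial>S)"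
      by (simp add: nn_integral_grid_term[OF m])
    also have "(\<integral>\<^sup>+x. ennreal (exp (- \<mu> * (pmax x k - psum x k))) \<partial>S) = (\<integral>\<^sup>+x. ennreal (exp (- \<mu> * pmax (\<lambda>i. - x i) k)) \<partial>S)"
      by (rule nn_integral_pmax_reversal[of "\<lambda>y. ennreal (exp (- \<mu> * y))"]) measurable
    also have "\<dots> = (\<integral>\<^sup>+\<omega>. ennreal (exp (- \<mu> * pmax (\<lambda>i. - incr (\<lambda>t. B t \<omega>) m i) k)) \<partial>M)"
      by (rule nn_integral_increments[OF m, symmetric]) measurable
    also have "\<dots> = (\<integral>\<^sup>+\<omega>. ennreal (exp (- \<mu> * opposite.grid_max m k \<omega>)) \<partial>M)"
      unfolding opposite.grid_max_def by (simp add: incr_def[abs_def])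
    also have "ennreal (exp (- r / real m)) ^ k * \<dots> =
       (\<integral>\<^sup>+\<omega>. ennreal (exp (- r / real m)) ^ k * ennreal (exp (- \<mu> * opposite.grid_max m k \<omega>)) \<partial>M)"
      by (rule nn_integral_cmult[symmetric]) measurable
    also have "\<dots> = (\<integral>\<^sup>+\<omega>. ennreal (opposite.grid_term (- \<mu>) 0 m k \<omega>) \<partial>M)"
      by (intro nn_integral_cong)
        (simp add: opposite.grid_term_def ennreal_mult'[symmetric] ennreal_power exp_of_nat_mult[symmetric] exp_add[symmetric] mult.commute)
    finally show ?thesis .
  qed
  then show ?thesis
    by (simp add: sampled_value_eq_suminf[OF m] opposite.sampled_value_eq_suminf[OF m])
qed

lemma exponential_moment:
  assumes "0 \<le> t"
  shows "(\<integral>\<^sup>+\<omega>. ennreal (exp (l * B t \<omega>)) \<partial>M) = ennreal (exp (l\<^sup>2 * t / 2))"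
proof (cases "t = 0")
  case True
  then show ?thesis by (simp add: path_0 emeasure_space_1 cong: nn_integral_cong)
next
  case False
  have "(\<integral>\<^sup>+\<omega>. ennreal (exp (l * B t \<omega>)) \<partial>M) =
     (\<integral>\<^sup>+x. ennreal (normal_density 0 (sqrt t) x) * ennreal (exp (l * x)) \<partial>lborel)"
    using False assms by (intro distributed_nn_integral[OF marginal_law, symmetric]) auto
  then show ?thesis using False assms by (simp add: normal_mgf)
qed

text \<open>The net discount rate is \<open>r\<close> minus the Gaussian growth rate
  \<open>l\<^sup>2 / 2\<close>; the exponential in the numerator absorbs the rounding of
  time.\<close>

lemma sampled_value_diagonal_le:
  assumes "l\<^sup>2 / 2 < r"
  shows "sampled_value l l (Suc j) \<le> ennreal (exp (r - l\<^sup>2 / 2) / (r - l\<^sup>2 / 2))"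
proof -
  define c where "c = r - l\<^sup>2 / 2"
  have c: "0 < c" using assms by (simp add: c_def)
  have mean: "(\<integral>\<^sup>+\<omega>. ennreal (grid_term l l m k \<omega>) \<partial>M) = ennreal (exp (- c * (real k / real m)))" for m k
  proof -
    have [measurable]: "B (real k / real m) \<in> borel_measurable M"
      by (intro measurable_path) auto
    have "(\<integral>\<^sup>+\<omega>. ennreal (grid_term l l m k \<omega>) \<partial>M) =
       (\<integral>\<^sup>+\<omega>. ennreal (exp (- r * (real k / real m))) * ennreal (exp (l * B (real k / real m) \<omega>)) \<partial>M)"
      by (intro nn_integral_cong)
        (simp add: grid_term_def ennreal_mult'[symmetric] exp_add[symmetric] algebra_simps)
    also have "\<dots> = ennreal (exp (- r * (real k / real m))) * ennreal (exp (l\<^sup>2 * (real k / real m) / 2))"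
      by (subst nn_integral_cmult) (auto simp: exponential_moment)
    also have "\<dots> = ennreal (exp (- c * (real k / real m)))"
      by (simp add: ennreal_mult'[symmetric] exp_add[symmetric] c_def algebra_simps)
    finally show ?thesis .
  qed
  have "sampled_value l l (Suc j) = (\<integral>\<^sup>+t. \<integral>\<^sup>+\<omega>. ennreal (sampled l l (Suc j) (t, \<omega>)) \<partial>M \<partial>lborel)"
    unfolding sampled_value_def by (rule nn_integral_fst[symmetric]) measurable
  also have "\<dots> = (\<integral>\<^sup>+t. ennreal (exp (- c * (real (nat \<lfloor>real (Suc j) * t\<rfloor>) / real (Suc j)))) * indicator {0..} t \<partial>lborel)"
    by (intro nn_integral_cong) (auto simp: sampled_def indicator_def mean simp del: of_nat_Suc)
  also have "\<dots> \<le> (\<integral>\<^sup>+t. ennreal (exp c) * (ennreal (exp (- c * t)) * indicator {0..} t) \<partial>lborel)"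
  proof (rule nn_integral_mono)
    fix t :: real
    have "ennreal (exp (- c * (real (nat \<lfloor>real (Suc j) * t\<rfloor>) / real (Suc j)))) \<le> ennreal (exp (c + - c * t))"
      using exp_floor_le[of c j t] c by (intro ennreal_leI) (simp del: of_nat_Suc)
    also have "\<dots> = ennreal (exp c) * ennreal (exp (- c * t))"
      by (simp only: exp_add ennreal_mult' exp_ge_zero)
    finally show "ennreal (exp (- c * (real (nat \<lfloor>real (Suc j) * t\<rfloor>) / real (Suc j)))) * indicator {0..} t
        \<le> ennreal (exp c) * (ennreal (exp (- c * t)) * indicator {0..} t)"
      by (auto simp: indicator_def)
  qed
  also have "\<dots> = ennreal (exp c) * ennreal (1 / c)"
    unfolding nn_integral_exp_discount[OF c, symmetric] by (rule nn_integral_cmult) measurable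
  also have "\<dots> = ennreal (exp c / c)"
    by (simp add: ennreal_mult'[symmetric])
  finally show ?thesis by (simp add: c_def)
qed

lemma sampled_value_0_tendsto:
  assumes "0 \<le> \<mu>"
  shows "(\<lambda>j. sampled_value 0 \<mu> (Suc j)) \<longlonglongrightarrow> limit_value 0 \<mu>"
  using assms by (intro sampled_value_tendsto) (auto simp: limit_value_0_0)

lemma limit_value_reversal:
  assumes "0 \<le> \<mu>"
  shows "limit_value 0 \<mu> = opposite.limit_value (- \<mu>) 0"
proof (rule LIMSEQ_unique[OF sampled_value_0_tendsto[OF assms]])
  have "(\<lambda>j. opposite.sampled_value (- \<mu>) 0 (Suc j)) \<longlonglongrightarrow> opposite.limit_value (- \<mu>) 0"
    using assms by (intro opposite.sampled_value_tendsto) (auto simp: opposite.limit_value_0_0 max_def)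
  then show "(\<lambda>j. sampled_value 0 \<mu> (Suc j)) \<longlonglongrightarrow> opposite.limit_value (- \<mu>) 0"
    by (simp add: sampled_value_reversal)
qed

lemma limit_value_0_finite:
  assumes "0 \<le> \<mu>"
  shows "limit_value 0 \<mu> < \<infinity>"
proof -
  have "limit_value 0 \<mu> \<le> limit_value 0 0"
    unfolding limit_value_def
  proof (rule nn_integral_mono)
    fix z assume "z \<in> space time_path_space"
    then obtain t \<omega> where z: "z = (t, \<omega>)" and \<omega>: "\<omega> \<in> space M"
      by (cases z) (auto simp: space_pair_measure)
    have "0 \<le> t \<Longrightarrow> 0 \<le> \<mu> * (path_max t \<omega> - B t \<omega>)"
      using assms path_max_ge[OF \<omega>] by (intro mult_nonneg_nonneg) auto
    then show "ennreal (limiting 0 \<mu> z) \<le> ennreal (limiting 0 0 z)"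
      by (auto simp: z limiting_def indicator_def intro!: ennreal_leI)
  qed
  then show ?thesis by (simp add: limit_value_0_0 le_less_trans)
qed

text \<open>
  For \<open>\<mu> = l\<close> the running maximum cancels, so the left-hand side of \<open>sampled_value_mult\<close> is an
  explicit Gaussian integral. As the other factor on the right stays away from \<open>0\<close>, this bounds
  the exponential moment of the running maximum without the reflection principle.
\<close>

lemma limit_value_finite:
  assumes "0 \<le> l" "l\<^sup>2 / 2 < r"
  shows "limit_value l 0 < \<infinity>"
proof -
  obtain \<epsilon> where \<epsilon>: "0 < \<epsilon>" "\<epsilon> < limit_value 0 l"
    using dense[OF limit_value_pos] by blast
  \<comment> \<open>The added 1 puts \<open>b0\<close> strictly above the limit
    \<open>1 / r\<close>, so \<open>sampled_value 0 0\<close> is eventually below it, just as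
    \<open>\<epsilon>\<close> is eventually exceeded by \<open>sampled_value 0 l\<close>.\<close>
  define b0 where "b0 = ennreal (1 / r) + 1"
  define b1 where "b1 = ennreal (exp (r - l\<^sup>2 / 2) / (r - l\<^sup>2 / 2))"
  have "ennreal (1 / r) < b0" unfolding b0_def using ennreal_add_left_cancel_less[of "ennreal (1 / r)" 0 1] by simp
  then have ev0: "\<forall>\<^sub>F j in sequentially. sampled_value 0 0 (Suc j) < b0"
    using order_tendstoD(2)[OF sampled_value_0_tendsto[of 0]] by (simp add: limit_value_0_0)
  have ev1: "\<forall>\<^sub>F j in sequentially. \<epsilon> < sampled_value 0 l (Suc j)"
    using order_tendstoD(1)[OF sampled_value_0_tendsto[OF assms(1)] \<epsilon>(2)] .
  have "\<forall>\<^sub>F j in sequentially. sampled_value l 0 (Suc j) \<le> b1 * b0 / \<epsilon>"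
    using ev0 ev1
  proof eventually_elim
    case (elim j)
    have "sampled_value l 0 (Suc j) * \<epsilon> \<le> sampled_value l 0 (Suc j) * sampled_value 0 l (Suc j)"
      using elim by (intro mult_left_mono) auto
    also have "\<dots> = sampled_value l l (Suc j) * sampled_value 0 0 (Suc j)"
      by (rule sampled_value_mult[symmetric]) simp
    also have "\<dots> \<le> b1 * b0"
      unfolding b1_def using elim sampled_value_diagonal_le[OF assms(2)] by (intro mult_mono) auto
    finally have "sampled_value l 0 (Suc j) * \<epsilon> / \<epsilon> \<le> b1 * b0 / \<epsilon>"
      by (rule divide_right_mono_ennreal)
    moreover have "\<epsilon> \<noteq> 0" "\<epsilon> \<noteq> top" using \<epsilon> by (auto simp: less_top[symmetric] dest: less_trans)
    ultimately show ?case by (simp add: ennreal_mult_divide_eq)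
  qed
  then have "liminf (\<lambda>j. sampled_value l 0 (Suc j)) \<le> b1 * b0 / \<epsilon>"
    by (intro Liminf_le) auto
  moreover have "b1 * b0 / \<epsilon> < \<infinity>"
    using gr_implies_not_zero[OF \<epsilon>(1)] by (simp add: b0_def b1_def ennreal_divide_eq_top_iff ennreal_mult_eq_top_iff less_top[symmetric])
  ultimately show ?thesis
    using limit_value_le_liminf[of l 0] by (auto intro: le_less_trans)
qed

text \<open>The limit of \<open>sampled_value_mult\<close>. The factor \<open>1 / r\<close> is
  \<open>limit_value 0 0\<close>, the mass of the unnormalized exponential weight.\<close>

lemma limit_value_factorization:
  assumes "0 \<le> l" "l\<^sup>2 / 2 < r" "0 \<le> \<mu>"
  shows "limit_value l \<mu> * ennreal (1 / r) = limit_value l 0 * opposite.limit_value (- \<mu>) 0"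
proof -
  have fin: "limit_value l 0 < \<infinity>" by (rule limit_value_finite) fact+
  have conv: "(\<lambda>j. sampled_value l \<nu> (Suc j)) \<longlonglongrightarrow> limit_value l \<nu>" if "0 \<le> \<nu>" for \<nu>
    using that fin assms(1) by (intro sampled_value_tendsto) (auto simp: max_def)
  have pos: "limit_value l \<nu> \<noteq> 0" for l \<nu>
    using limit_value_pos[of l \<nu>] by simp
  have "(\<lambda>j. sampled_value l \<mu> (Suc j) * sampled_value 0 0 (Suc j)) \<longlonglongrightarrow> limit_value l \<mu> * limit_value 0 0"
    using assms by (intro tendsto_mult_ennreal conv sampled_value_0_tendsto) (auto simp: pos)
  moreover have "(\<lambda>j. sampled_value l 0 (Suc j) * sampled_value 0 \<mu> (Suc j)) \<longlonglongrightarrow> limit_value l 0 * limit_value 0 \<mu>"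
    using assms by (intro tendsto_mult_ennreal conv sampled_value_0_tendsto) (auto simp: pos)
  ultimately have "limit_value l \<mu> * limit_value 0 0 = limit_value l 0 * limit_value 0 \<mu>"
    by (simp add: sampled_value_mult LIMSEQ_unique)
  then show ?thesis
    by (simp add: limit_value_0_0 limit_value_reversal[OF assms(3)])
qed

end

section \<open>Brownian motion\<close>

text \<open>
  The conjuncts are selected by hand because right-continuity of the filtration, used as a
  rewrite rule for \<open>sets (F t)\<close>, makes the simplifier loop.
\<close>

lemma usual_conditionsD:
  assumes "usual_conditions M F"
  shows "prob_space M"
    and "0 \<le> t \<Longrightarrow> subalgebra M (F t)"
    and "0 \<le> s \<Longrightarrow> s \<le> t \<Longrightarrow> sets (F s) \<subseteq> sets (F t)"
proof -
  note * = assms[unfolded usual_conditions_def]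
  show "prob_space M" by (rule conjunct1[OF *])
  show "0 \<le> t \<Longrightarrow> subalgebra M (F t)" using *[THEN conjunct2, THEN conjunct2, THEN conjunct1] by simp
  show "0 \<le> s \<Longrightarrow> s \<le> t \<Longrightarrow> sets (F s) \<subseteq> sets (F t)" 
    using *[THEN conjunct2, THEN conjunct2, THEN conjunct2, THEN conjunct1] by simp
qed

lemma brownian_motion_measurable:
  assumes "usual_conditions M F" "brownian_motion M F W" "0 \<le> s" "s \<le> t"
  shows "W s \<in> borel_measurable (F t)" "W s \<in> borel_measurable M"
proof -
  have t: "0 \<le> t" using assms(3,4) by simp
  note uc = usual_conditionsD[OF assms(1)]
  have "subalgebra (F t) (F s)"
    using uc(2)[OF assms(3)] uc(2)[OF t] uc(3)[OF assms(3,4)] by (simp add: subalgebra_def)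
  moreover have "W s \<in> borel_measurable (F s)"
    using assms(2,3) by (simp add: brownian_motion_def adapted_def)
  ultimately show *: "W s \<in> borel_measurable (F t)"
    by (rule measurable_from_subalg)
  show "W s \<in> borel_measurable M"
    by (rule measurable_from_subalg[OF uc(2)[OF t] *])
qed

lemma brownian_motion_uminus:
  assumes uc: "usual_conditions M F" and bm: "brownian_motion M F W"
  shows "brownian_motion M F (\<lambda>t \<omega>. - W t \<omega>)"
  unfolding brownian_motion_def
proof (intro conjI allI impI)
  interpret prob_space M by (rule usual_conditionsD(1)[OF uc])
  show "adapted F (\<lambda>t \<omega>. - W t \<omega>)"
    using bm by (auto simp: brownian_motion_def adapted_def)
  show "AE \<omega> in M. - W 0 \<omega> = 0" "AE \<omega> in M. continuous_on {0..} (\<lambda>t. - W t \<omega>)"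
  proof -
    have "AE \<omega> in M. W 0 \<omega> = 0" "AE \<omega> in M. continuous_on {0..} (\<lambda>t. W t \<omega>)"
      using bm by (auto simp: brownian_motion_def)
    then show "AE \<omega> in M. - W 0 \<omega> = 0" "AE \<omega> in M. continuous_on {0..} (\<lambda>t. - W t \<omega>)"
      by (simp, elim eventually_mono continuous_on_minus)
  qed
  fix s t :: real assume st: "0 \<le> s" "s < t"
  then have d: "distributed M lborel (\<lambda>\<omega>. W t \<omega> - W s \<omega>) (normal_density 0 (sqrt (t - s)))"
    and ind: "indep_set (sets (F s)) {(\<lambda>\<omega>. W t \<omega> - W s \<omega>) -` A \<inter> space M | A. A \<in> sets borel}"
    using bm by (auto simp: brownian_motion_def)
  show "distributed M lborel (\<lambda>\<omega>. - W t \<omega> - - W s \<omega>) (normal_density 0 (sqrt (t - s)))"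
    using normal_density_affine[OF d, of "-1" 0] st by simp
  have "{(\<lambda>\<omega>. - W t \<omega> - - W s \<omega>) -` A \<inter> space M | A. A \<in> sets borel}
      \<subseteq> {(\<lambda>\<omega>. W t \<omega> - W s \<omega>) -` A \<inter> space M | A. A \<in> sets borel}"
  proof safe
    fix A :: "real set" assume A: "A \<in> sets borel"
    have "uminus -` A \<inter> space borel \<in> sets borel"
      using A by (intro measurable_sets[where A = borel]) auto
    then have "uminus -` A \<in> sets borel" by simp
    moreover have "(\<lambda>\<omega>. - W t \<omega> - - W s \<omega>) -` A = (\<lambda>\<omega>. W t \<omega> - W s \<omega>) -` (uminus -` A)"
      by auto
    ultimately show "\<exists>A'. (\<lambda>\<omega>. - W t \<omega> - - W s \<omega>) -` A \<inter> space M = (\<lambda>\<omega>. W t \<omega> - W s \<omega>) -` A' \<inter> space M \<and> A' \<in> sets borel"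
      by auto
  qed
  then show "indep_set (sets (F s)) {(\<lambda>\<omega>. - W t \<omega> - - W s \<omega>) -` A \<inter> space M | A. A \<in> sets borel}"
    using ind unfolding indep_set_def by (elim indep_sets_mono_sets) (simp split: bool.split)
qed

text \<open>The definition makes each increment independent of the past only. Mutual independence on
  the grid follows by adding one increment at a time.\<close>

lemma brownian_motion_incr_law:
  assumes uc: "usual_conditions M F" and bm: "brownian_motion M F W" and m: "0 < m"
  shows "distr M (\<Pi>\<^sub>M i\<in>UNIV. borel) (\<lambda>\<omega>. incr (\<lambda>t. W t \<omega>) m) =
    (\<Pi>\<^sub>M i\<in>UNIV. density lborel (normal_density 0 (sqrt (1 / real m))))"
proof -
  interpret prob_space M by (rule usual_conditionsD(1)[OF uc])
  define X where "X i \<omega> = incr (\<lambda>t. W t \<omega>) m i" for i \<omega>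
  define T where "T i = real i / real m" for i
  have T: "0 \<le> T i" "T i < T (Suc i)" "T (Suc i) - T i = 1 / real m" for i
    using m by (auto simp: T_def divide_strict_right_mono simp flip: diff_divide_distrib)
  have X: "X i = (\<lambda>\<omega>. W (T (Suc i)) \<omega> - W (T i) \<omega>)" for i
    by (simp add: X_def incr_def T_def fun_eq_iff)
  have F_mono: "sets (F s) \<subseteq> sets (F t)" if "0 \<le> s" "s \<le> t" for s t
    by (rule usual_conditionsD(3)[OF uc that])
  have space_F: "space (F (T n)) = space M" for n
    using usual_conditionsD(2)[OF uc T(1)] by (simp add: subalgebra_def)
  have increments: "distributed M lborel (\<lambda>\<omega>. W (T (Suc i)) \<omega> - W (T i) \<omega>) (normal_density 0 (sqrt (T (Suc i) - T i)))"
    "indep_set (sets (F (T i))) {(\<lambda>\<omega>. W (T (Suc i)) \<omega> - W (T i) \<omega>) -` A \<inter> space M | A. A \<in> sets borel}" for i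
    using bm T[of i] unfolding brownian_motion_def by blast+
  have X_F: "X i \<in> borel_measurable (F (T (Suc i)))" for i
    unfolding X using T[of i] by (intro borel_measurable_diff brownian_motion_measurable[OF uc bm]) auto
  have X_M: "X i \<in> borel_measurable M" for i
    unfolding X using T[of i] by (intro borel_measurable_diff brownian_motion_measurable(2)[OF uc bm]) auto
  \<comment> \<open>Membership in \<open>F (T n)\<close> is carried through the induction because
    the next increment is independent of exactly this sigma-algebra.\<close>
  have initial: "{\<omega>\<in>space M. \<forall>j<n. X j \<omega> \<in> A j} \<in> sets (F (T n)) \<and>
      prob {\<omega>\<in>space M. \<forall>j<n. X j \<omega> \<in> A j} = (\<Prod>j<n. prob (X j -` A j \<inter> space M))"
    if A: "\<And>j. A j \<in> sets borel" for A n
  proof (induction n)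
    case 0
    then show ?case using sets.top[of "F (T 0)"] by (simp add: space_F prob_space)
  next
    case (Suc n)
    define E where "E = {\<omega>\<in>space M. \<forall>j<n. X j \<omega> \<in> A j}"
    define G where "G = X n -` A n \<inter> space M"
    have split: "{\<omega>\<in>space M. \<forall>j<Suc n. X j \<omega> \<in> A j} = E \<inter> G"
      by (auto simp: E_def G_def less_Suc_eq)
    have E: "E \<in> sets (F (T n))" using Suc unfolding E_def by (rule conjunct1)
    moreover have "sets (F (T n)) \<subseteq> sets (F (T (Suc n)))"
      using T[of n] by (intro F_mono) auto
    moreover have "G \<in> sets (F (T (Suc n)))"
      using measurable_sets[OF X_F A] by (simp add: G_def space_F)
    ultimately have 1: "E \<inter> G \<in> sets (F (T (Suc n)))" by auto
    have "indep_set (sets (F (T n))) {X n -` A \<inter> space M | A. A \<in> sets borel}"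
      unfolding X by (rule increments)
    then have 2: "prob (E \<inter> G) = prob E * prob G"
      using E A by (intro indep_setD) (auto simp: G_def)
    have 3: "prob E = (\<Prod>j<n. prob (X j -` A j \<inter> space M))"
      using Suc unfolding E_def by (rule conjunct2)
    show ?case
      unfolding split using 1 2 3 by (simp add: G_def)
  qed
  have "indep_vars (\<lambda>_. borel) X UNIV"
    unfolding indep_vars_def2
  proof (intro conjI ballI indep_setsI)
    fix A :: "nat \<Rightarrow> 'a set" and J :: "nat set"
    assume J: "J \<noteq> {}" "finite J" and "\<forall>j\<in>J. A j \<in> {X j -` A \<inter> space M |A. A \<in> sets borel}"
    then have "\<forall>j\<in>J. \<exists>C. A j = X j -` C \<inter> space M \<and> C \<in> sets borel" by auto
    then obtain C' where C': "\<And>j. j \<in> J \<Longrightarrow> A j = X j -` C' j \<inter> space M \<and> C' j \<in> sets borel"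
      by metis
    \<comment> \<open>Indices outside \<open>J\<close> receive the sure event, of probability 1,
      which extends \<open>J\<close> to an initial segment covered by
      \<open>initial\<close>.\<close>
    define C where "C j = (if j \<in> J then C' j else UNIV)" for j
    define n where "n = Suc (Max J)"
    have Jn: "J \<subseteq> {..<n}" using J by (auto simp: n_def less_Suc_eq_le)
    have "(\<Inter>j\<in>J. A j) = {\<omega>\<in>space M. \<forall>j<n. X j \<omega> \<in> C j}"
    proof (rule set_eqI)
      fix \<omega>
      have "\<omega> \<in> (\<Inter>j\<in>J. A j) \<longleftrightarrow> (\<forall>j\<in>J. X j \<omega> \<in> C' j \<and> \<omega> \<in> space M)"
        using C' by blast
      also have "\<dots> \<longleftrightarrow> \<omega> \<in> {\<omega>\<in>space M. \<forall>j<n. X j \<omega> \<in> C j}"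
      proof
        assume L: "\<forall>j\<in>J. X j \<omega> \<in> C' j \<and> \<omega> \<in> space M"
        moreover have "\<omega> \<in> space M" using L J(1) by blast
        ultimately show "\<omega> \<in> {\<omega>\<in>space M. \<forall>j<n. X j \<omega> \<in> C j}" by (simp add: C_def)
      next
        assume R: "\<omega> \<in> {\<omega>\<in>space M. \<forall>j<n. X j \<omega> \<in> C j}"
        show "\<forall>j\<in>J. X j \<omega> \<in> C' j \<and> \<omega> \<in> space M"
        proof
          fix j assume "j \<in> J"
          then have "j < n" using Jn by blast
          then have "X j \<omega> \<in> C j" "\<omega> \<in> space M" using R by simp_all
          then show "X j \<omega> \<in> C' j \<and> \<omega> \<in> space M" using \<open>j \<in> J\<close> by (simp add: C_def)
        qed
      qed
      finally show "\<omega> \<in> (\<Inter>j\<in>J. A j) \<longleftrightarrow> \<omega> \<in> {\<omega>\<in>space M. \<forall>j<n. X j \<omega> \<in> C j}" .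
    qed
    also have "prob \<dots> = (\<Prod>j<n. prob (X j -` C j \<inter> space M))"
      using C' by (intro conjunct2[OF initial]) (simp add: C_def)
    also have "\<dots> = (\<Prod>j\<in>J. prob (X j -` C j \<inter> space M))"
      using Jn by (intro prod.mono_neutral_right) (auto simp: C_def prob_space)
    also have "\<dots> = (\<Prod>j\<in>J. prob (A j))"
      by (intro prod.cong) (simp_all add: C_def C')
    finally show "prob (\<Inter>j\<in>J. A j) = (\<Prod>j\<in>J. prob (A j))" .
  next
    fix i
    show "X i \<in> borel_measurable M" by (rule X_M)
    show "{X i -` A \<inter> space M |A. A \<in> sets borel} \<subseteq> events"
      using measurable_sets[OF X_M] by blast
  qed
  then have "distr M (\<Pi>\<^sub>M i\<in>UNIV. borel) (\<lambda>\<omega>. \<lambda>i\<in>UNIV. X i \<omega>) = (\<Pi>\<^sub>M i\<in>UNIV. distr M borel (X i))"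
    using X_M by (subst (asm) indep_vars_iff_distr_eq_PiM) auto
  moreover have "distr M borel (X i) = density lborel (normal_density 0 (sqrt (1 / real m)))" for i
  proof -
    have "distributed M lborel (X i) (normal_density 0 (sqrt (1 / real m)))"
      unfolding X T(3)[of i, symmetric] by (rule increments)
    then have "distr M lborel (X i) = density lborel (normal_density 0 (sqrt (1 / real m)))"
      by (simp add: distributed_def)
    moreover have "distr M borel (X i) = distr M lborel (X i)"
      by (rule distr_cong) auto
    ultimately show ?thesis by simp
  qed
  ultimately show ?thesis
    by (simp add: restrict_def X_def)
qed

text \<open>Paths are set to 0 on a single null set that contains all defects. As this set does not
  depend on time, suprema and time integrals of the two processes agree outside it.\<close>

lemma brownian_motion_continuous_version:
  assumes uc: "usual_conditions M F" and bm: "brownian_motion M F W" and r: "0 < r"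
  obtains B where "continuous_brownian M B r" "AE \<omega> in M. \<forall>t. W t \<omega> = B t \<omega>"
proof -
  interpret prob_space M by (rule usual_conditionsD(1)[OF uc])
  have "AE \<omega> in M. W 0 \<omega> = 0 \<and> continuous_on {0..} (\<lambda>t. W t \<omega>)"
    using bm by (auto simp: brownian_motion_def)
  then obtain Z where Z: "Z \<in> null_sets M"
    "\<And>\<omega>. \<omega> \<in> space M - Z \<Longrightarrow> W 0 \<omega> = 0 \<and> continuous_on {0..} (\<lambda>t. W t \<omega>)"
    by (auto elim!: AE_E3)
  define B where "B t \<omega> = (if \<omega> \<in> Z then 0 else W t \<omega>)" for t \<omega>
  have AE_eq: "AE \<omega> in M. \<forall>t. W t \<omega> = B t \<omega>"
    using AE_not_in[OF Z(1)] by eventually_elim (simp add: B_def)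
  have Z_sets [measurable]: "Z \<in> sets M" using Z by auto
  have W_meas: "W t \<in> borel_measurable M" if "0 \<le> t" for t
    using brownian_motion_measurable(2)[OF uc bm that] by auto
  have B_meas: "B t \<in> borel_measurable M" if "0 \<le> t" for t
  proof -
    note [measurable] = W_meas[OF that]
    show ?thesis unfolding B_def[abs_def] by measurable
  qed
  interpret process: continuous_process M B r
  proof unfold_locales
    fix \<omega> assume "\<omega> \<in> space M"
    then show "continuous_on {0..} (\<lambda>t. B t \<omega>)" "B 0 \<omega> = 0"
      using Z(2)[of \<omega>] by (cases "\<omega> \<in> Z"; simp add: B_def)+
  qed (rule B_meas, assumption, rule r)
  have "continuous_brownian M B r"
  proof unfold_locales
    fix m :: nat assume m: "0 < m"
    have "distr M (\<Pi>\<^sub>M i\<in>UNIV. borel) (\<lambda>\<omega>. incr (\<lambda>t. B t \<omega>) m) =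
        distr M (\<Pi>\<^sub>M i\<in>UNIV. borel) (\<lambda>\<omega>. incr (\<lambda>t. W t \<omega>) m)"
    proof (rule distr_cong_AE)
      show "AE \<omega> in M. incr (\<lambda>t. B t \<omega>) m = incr (\<lambda>t. W t \<omega>) m"
        using AE_eq by eventually_elim (simp add: incr_def[abs_def])
      show "(\<lambda>\<omega>. incr (\<lambda>t. B t \<omega>) m) \<in> measurable M (\<Pi>\<^sub>M i\<in>UNIV. borel)"
        by (rule measurable_PiM_single') (auto intro: process.measurable_incr)
      show "(\<lambda>\<omega>. incr (\<lambda>t. W t \<omega>) m) \<in> measurable M (\<Pi>\<^sub>M i\<in>UNIV. borel)"
        by (rule measurable_PiM_single') (auto simp: incr_def intro!: borel_measurable_diff W_meas)
    qed simp_all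
    then show "distr M (\<Pi>\<^sub>M i\<in>UNIV. borel) (\<lambda>\<omega>. incr (\<lambda>t. B t \<omega>) m) =
      (\<Pi>\<^sub>M i\<in>UNIV. density lborel (normal_density 0 (sqrt (1 / real m))))"
      by (simp add: brownian_motion_incr_law[OF uc bm m])
  next
    fix t :: real assume t: "0 < t"
    \<comment> \<open>Only increments have prescribed laws; the marginal is that of the increment
      from time 0, where \<open>B\<close> vanishes.\<close>
    have d: "distributed M lborel (\<lambda>\<omega>. W t \<omega> - W 0 \<omega>) (normal_density 0 (sqrt (t - 0)))"
      using bm t unfolding brownian_motion_def by blast
    have "distr M lborel (B t) = distr M lborel (\<lambda>\<omega>. W t \<omega> - W 0 \<omega>)"
    proof (rule distr_cong_AE)
      show "AE \<omega> in M. B t \<omega> = W t \<omega> - W 0 \<omega>"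
        using AE_eq AE_space by eventually_elim (simp add: process.path_0)
      have "B t \<in> borel_measurable M" "W t \<in> borel_measurable M" "W 0 \<in> borel_measurable M"
        using t by (auto intro!: B_meas W_meas)
      then show "B t \<in> measurable M lborel" "(\<lambda>\<omega>. W t \<omega> - W 0 \<omega>) \<in> measurable M lborel"
        by simp_all
    qed simp_all
    with d t B_meas show "distributed M lborel (B t) (normal_density 0 (sqrt t))"
      by (simp add: distributed_def)
  qed
  then show thesis using AE_eq by (rule that)
qed

section \<open>The cost ratio\<close>

text \<open>The weight \<open>c\<close> lets one formula serve both budget constants:
  \<open>c = 1\<close> for the planner, \<open>c = 1 / n\<close> for a single agent. Here
  \<open>v\<close> is the public cost and \<alpha> / \<beta> the ratio of private to public
  cost.\<close>

lemma expected_cost_explicit: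
  fixes M :: "'a measure" and F :: "real \<Rightarrow> 'a measure"
    and W \<E>x \<psi>x \<psi>c \<gamma> \<theta> :: "real \<Rightarrow> 'a \<Rightarrow> real"
    and r \<sigma> \<alpha> \<beta> :: real
  assumes uc: "usual_conditions M F" and bm: "brownian_motion M F W"
    and r: "r > 0" and \<sigma>: "\<sigma> > 0"
    and \<alpha>: "0 < \<alpha>" and \<beta>: "0 < \<beta>" and \<alpha>\<beta>: "\<alpha> + \<beta> < 1"
    and discount: "sqrt (2 * r) > \<sigma> * \<alpha> / (1 - \<alpha> - \<beta>)"
    and \<E>x: "\<E>x = (\<lambda>t \<omega>. exp (\<sigma> * W t \<omega>))"
    and \<psi>x: "\<psi>x = (\<lambda>t \<omega>. exp (- r * t) * \<E>x t \<omega>)"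
    and \<psi>c: "\<psi>c = (\<lambda>t \<omega>. exp (- r * t))"
    and \<theta>: "\<theta> = theta_process \<alpha> \<beta> \<E>x"
    and \<gamma>: "\<gamma> = gamma_process M r \<alpha> \<beta> \<E>x"
  shows "AE \<omega> in M. \<forall>t\<ge>0. 0 < \<theta> t \<omega>"
    and "\<exists>v>0. \<forall>c\<ge>0. (\<integral>\<^sup>+\<omega>. time_integral (\<lambda>t. \<psi>x t \<omega> * \<gamma> t \<omega>)
            + ennreal c * stieltjes (\<lambda>t. \<psi>c t \<omega>) (\<lambda>t. \<theta> t \<omega>) \<partial>M) = ennreal (v * (\<alpha> / \<beta> + c))"
proof -
  obtain B where "continuous_brownian M B r" and WB: "AE \<omega> in M. \<forall>t. - W t \<omega> = B t \<omega>"
    using brownian_motion_continuous_version[OF uc brownian_motion_uminus[OF uc bm] r] by blast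
  then interpret continuous_brownian M B r by simp
  define l where "l = \<sigma> * (\<alpha> / (1 - \<alpha> - \<beta>))"
  define \<mu> where "\<mu> = \<sigma> * (\<alpha> / (1 - \<alpha>))"
  \<comment> \<open>The constant factor of \<open>\<gamma>\<close>. As 1 / (\<alpha> - 1) = - (1 /
    (1 - \<alpha>)), the same power occurs in \<open>delta_const\<close>, so
    \<open>k / \<delta>\<close> is \<alpha> / \<beta>.\<close>
  define k where "k = ((\<alpha> + \<beta>) / \<alpha>) powr (- (1 / (1 - \<alpha>)))"
  define \<delta> where "\<delta> = \<beta> / \<alpha> * k"
  have lpos: "0 \<le> l" using \<sigma> \<alpha> \<alpha>\<beta> by (simp add: l_def)
  have \<mu>pos: "0 \<le> \<mu>" using \<sigma> \<alpha> \<beta> \<alpha>\<beta> by (simp add: \<mu>_def)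
  have kpos: "0 < k" using \<alpha> \<beta> by (simp add: k_def)
  have \<delta>pos: "0 < \<delta>" using \<alpha> \<beta> kpos by (simp add: \<delta>_def)
  \<comment> \<open>This is the discount hypothesis \<open>l < sqrt (2 * r)\<close>,
    squared.\<close>
  have l_r: "l\<^sup>2 / 2 < r"
  proof -
    have "l < sqrt (2 * r)" using discount by (simp add: l_def)
    then have "l\<^sup>2 < (sqrt (2 * r))\<^sup>2" using lpos by (intro power_strict_mono) auto
    then show ?thesis using r by simp
  qed
  have "delta_const \<alpha> \<beta> = \<delta>"
  proof -
    have "1 / (\<alpha> - 1) = - (1 / (1 - \<alpha>))" using \<alpha>\<beta> \<beta> by (simp add: field_simps)
    then show ?thesis by (simp add: delta_const_def \<delta>_def k_def)
  qed
  have good: "AE \<omega> in M. \<omega> \<in> space M \<and> (\<forall>t. W t \<omega> = - B t \<omega>)"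
    using WB AE_space by eventually_elim (metis minus_minus)

  have \<theta>_eq: "\<theta> t \<omega> = exp (l * path_max t \<omega>)"
    if "\<omega> \<in> space M" "\<forall>t. W t \<omega> = - B t \<omega>" "0 \<le> t" for t \<omega>
  proof -
    have "\<theta> t \<omega> = (SUP s\<in>{0..t}. exp (l * B s \<omega>))"
      using that(2) by (simp add: \<theta> theta_process_def \<E>x exp_powr_real l_def mult_ac)
    also have "\<dots> = exp (l * path_max t \<omega>)"
      unfolding path_max_def
      by (rule SUP_mono_path[OF continuous_path[OF that(1)] that(3), of "\<lambda>x. exp (l * x)"])
        (auto simp: mono_def intro: mult_left_mono lpos)
    finally show ?thesis .
  qed
  show "AE \<omega> in M. \<forall>t\<ge>0. 0 < \<theta> t \<omega>"
    using good by eventually_elim (simp add: \<theta>_eq)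

  define v1 where "v1 = enn2real (limit_value l 0)"
  define v2 where "v2 = enn2real (opposite.limit_value (- \<mu>) 0)"
  have v1: "limit_value l 0 = ennreal v1" "0 < v1"
    using limit_value_finite[OF lpos l_r] limit_value_pos[of l 0]
    by (auto simp: v1_def enn2real_positive_iff)
  have v2: "opposite.limit_value (- \<mu>) 0 = ennreal v2" "0 < v2"
    using limit_value_0_finite[OF \<mu>pos] limit_value_pos[of 0 \<mu>] limit_value_reversal[OF \<mu>pos]
    by (auto simp: v2_def enn2real_positive_iff)
  have v12: "limit_value l \<mu> = ennreal (r * v1 * v2)"
  proof -
    have "limit_value l \<mu> = limit_value l \<mu> * ennreal (1 / r) * ennreal r"
      using r by (simp add: mult.assoc ennreal_mult'[symmetric])
    also have "\<dots> = ennreal v1 * ennreal v2 * ennreal r"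
      by (simp add: limit_value_factorization[OF lpos l_r \<mu>pos] v1 v2)
    also have "\<dots> = ennreal (r * v1 * v2)"
      using r v1 v2 by (simp add: ennreal_mult'[symmetric] mult_ac)
    finally show ?thesis .
  qed

  \<comment> \<open>The map s to u - s sends [0, u] onto itself, so the infimum is determined by the
    running maximum of \<open>- B\<close>, which is W.\<close>
  have A: "A_const M r \<alpha> \<beta> \<E>x = \<delta> * v2"
  proof -
    have "(\<integral>\<^sup>+ \<omega>. time_integral (\<lambda>u. delta_const \<alpha> \<beta> * exp (- r * u) *
       (INF s\<in>{0..u}. \<E>x (u - s) \<omega> powr (- (\<alpha> / (1 - \<alpha>))))) \<partial>M) =
       (\<integral>\<^sup>+\<omega>. ennreal \<delta> * opposite.discounted (- \<mu>) 0 \<omega> \<partial>M)"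
    proof (rule nn_integral_cong_AE, use good in eventually_elim)
      fix \<omega> assume \<omega>: "\<omega> \<in> space M \<and> (\<forall>t. W t \<omega> = - B t \<omega>)"
      have "(INF s\<in>{0..u}. \<E>x (u - s) \<omega> powr (- (\<alpha> / (1 - \<alpha>)))) = exp (- \<mu> * opposite.path_max u \<omega>)"
        if u: "0 \<le> u" for u
      proof -
        have "(INF s\<in>{0..u}. \<E>x (u - s) \<omega> powr (- (\<alpha> / (1 - \<alpha>)))) =
            (INF s\<in>{0..u}. exp (- \<mu> * - B (u - s) \<omega>))"
          using \<omega> by (simp add: \<E>x exp_powr_real \<mu>_def mult_ac)
        also have "\<dots> = (INF s\<in>(\<lambda>s. u - s) ` {0..u}. exp (- \<mu> * - B s \<omega>))"
          by (simp only: image_image)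
        also have "(\<lambda>s. u - s) ` {0..u} = {0..u}"
          by simp
        also have "(INF s\<in>{0..u}. exp (- \<mu> * - B s \<omega>)) = exp (- \<mu> * opposite.path_max u \<omega>)"
          unfolding opposite.path_max_def
          by (rule INF_antimono_path[OF opposite.continuous_path u, of \<omega> "\<lambda>x. exp (- \<mu> * x)"])
            (use \<omega> in \<open>auto simp: antimono_def intro: mult_left_mono \<mu>pos\<close>)
        finally show ?thesis .
      qed
      then show "time_integral (\<lambda>u. delta_const \<alpha> \<beta> * exp (- r * u) *
          (INF s\<in>{0..u}. \<E>x (u - s) \<omega> powr (- (\<alpha> / (1 - \<alpha>))))) =
        ennreal \<delta> * opposite.discounted (- \<mu>) 0 \<omega>"
        using \<omega> \<delta>pos \<open>delta_const \<alpha> \<beta> = \<delta>\<close>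
        by (intro opposite.time_integral_cmult_discounted) (auto simp: exp_add[symmetric])
    qed
    also have "\<dots> = ennreal \<delta> * ennreal v2"
      by (simp add: nn_integral_cmult opposite.nn_integral_discounted v2)
    finally show ?thesis
      using \<delta>pos v2 by (simp add: A_const_def ennreal_mult'[symmetric])
  qed

  have \<gamma>_eq: "\<psi>x t \<omega> * \<gamma> t \<omega> = k / (\<delta> * v2) * exp (- r * t + l * path_max t \<omega> - \<mu> * (path_max t \<omega> - B t \<omega>))"
    if "\<omega> \<in> space M" "\<forall>t. W t \<omega> = - B t \<omega>" "0 \<le> t" for t \<omega>
  proof -
    define q where "q = \<sigma> * (\<alpha> * \<beta> / (1 - \<alpha> - \<beta>))"
    have "0 \<le> q" using \<sigma> \<alpha> \<beta> \<alpha>\<beta> by (simp add: q_def)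
    have "(INF s\<in>{0..t}. \<E>x s \<omega> powr (\<alpha> * \<beta> / (1 - \<alpha> - \<beta>))) = (INF s\<in>{0..t}. exp (- q * B s \<omega>))"
      using that(2) by (simp add: \<E>x exp_powr_real q_def mult_ac)
    also have "\<dots> = exp (- q * path_max t \<omega>)"
      unfolding path_max_def
      by (rule INF_antimono_path[OF continuous_path[OF that(1)] that(3), of "\<lambda>x. exp (- q * x)"])
        (auto simp: antimono_def intro: mult_left_mono \<open>0 \<le> q\<close>)
    finally have inf: "(INF s\<in>{0..t}. \<E>x s \<omega> powr (\<alpha> * \<beta> / (1 - \<alpha> - \<beta>))) = exp (- q * path_max t \<omega>)" .
    have "\<gamma> t \<omega> = 1 / (\<delta> * v2) *
        ((\<alpha> + \<beta>) / \<alpha> * exp (- \<sigma> * B t \<omega> - q * path_max t \<omega>)) powr (- (1 / (1 - \<alpha>)))"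
      using that(2) by (simp add: \<gamma> gamma_process_def A inf) (simp add: \<E>x exp_add[symmetric] exp_minus[symmetric] mult.assoc)
    also have "((\<alpha> + \<beta>) / \<alpha> * exp (- \<sigma> * B t \<omega> - q * path_max t \<omega>)) powr (- (1 / (1 - \<alpha>))) =
        k * exp ((\<sigma> * B t \<omega> + q * path_max t \<omega>) / (1 - \<alpha>))"
      using \<alpha> \<beta> by (subst powr_mult) (auto simp: k_def exp_powr_real minus_divide_left[symmetric] add_divide_distrib algebra_simps)
    finally have "\<psi>x t \<omega> * \<gamma> t \<omega> = k / (\<delta> * v2) *
        exp (- r * t - \<sigma> * B t \<omega> + (\<sigma> * B t \<omega> + q * path_max t \<omega>) / (1 - \<alpha>))"
      using that(2) by (simp add: \<psi>x \<E>x exp_add exp_diff exp_minus field_simps)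
    also have "- r * t - \<sigma> * B t \<omega> + (\<sigma> * B t \<omega> + q * path_max t \<omega>) / (1 - \<alpha>) =
        - r * t + l * path_max t \<omega> - \<mu> * (path_max t \<omega> - B t \<omega>)"
    proof -
      have nz: "1 - \<alpha> \<noteq> 0" "1 - \<alpha> - \<beta> \<noteq> 0" using \<alpha>\<beta> \<beta> by auto
      \<comment> \<open>These identities bring the exponent of the private integrand into the form
        needed for the factorization: a multiple of the maximum minus a multiple of the drop below
        it.\<close>
      have coeff: "q / (1 - \<alpha>) = l - \<mu>" "\<sigma> / (1 - \<alpha>) = \<sigma> + \<mu>"
        unfolding q_def l_def \<mu>_def using nz by (simp_all add: divide_simps) (simp_all add: algebra_simps)
      have "(\<sigma> * B t \<omega> + q * path_max t \<omega>) / (1 - \<alpha>) =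
          (\<sigma> + \<mu>) * B t \<omega> + (l - \<mu>) * path_max t \<omega>"
        unfolding coeff[symmetric] by (simp add: add_divide_distrib)
      then show ?thesis by (simp add: algebra_simps)
    qed
    finally show ?thesis .
  qed

  have stieltjes_eq: "stieltjes (\<lambda>t. \<psi>c t \<omega>) (\<lambda>t. \<theta> t \<omega>) = ennreal r * discounted l 0 \<omega>"
    if \<omega>: "\<omega> \<in> space M" "\<forall>t. W t \<omega> = - B t \<omega>" for \<omega>
  proof -
    have "stieltjes (\<lambda>t. exp (- r * t)) (\<lambda>t. \<theta> t \<omega>) = ennreal r * time_integral (\<lambda>t. exp (- r * t) * \<theta> t \<omega>)"
    proof (rule stieltjes_exp_discount[OF r])
      fix t :: real assume t: "0 \<le> t"
      show "0 \<le> \<theta> t \<omega>" using \<theta>_eq[OF \<omega> t] by simp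
      have "((\<lambda>s. exp (l * path_max s \<omega>)) \<longlongrightarrow> exp (l * path_max t \<omega>)) (at_right t)"
        using runmax_right_continuous[OF continuous_path[OF \<omega>(1)] t]
        unfolding continuous_within path_max_def by (intro tendsto_intros)
      moreover have "\<forall>\<^sub>F s in at_right t. exp (l * path_max s \<omega>) = \<theta> s \<omega>"
        unfolding eventually_at_right_field using t \<theta>_eq[OF \<omega>] by (intro exI[of _ "t + 1"]) auto
      ultimately have "((\<lambda>s. \<theta> s \<omega>) \<longlongrightarrow> exp (l * path_max t \<omega>)) (at_right t)"
        by (rule Lim_transform_eventually)
      then show "continuous (at_right t) (\<lambda>s. \<theta> s \<omega>)"
        by (simp add: continuous_within \<theta>_eq[OF \<omega> t])
    next
      fix s t :: real assume st: "0 \<le> s" "s \<le> t"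
      then have "path_max s \<omega> \<le> path_max t \<omega>"
        unfolding path_max_def by (intro runmax_mono continuous_path \<omega>)
      then show "\<theta> s \<omega> \<le> \<theta> t \<omega>"
        using st lpos by (simp add: \<theta>_eq[OF \<omega>] mult_left_mono)
    qed
    also have "time_integral (\<lambda>t. exp (- r * t) * \<theta> t \<omega>) = ennreal 1 * discounted l 0 \<omega>"
      using \<omega> by (intro time_integral_cmult_discounted) (auto simp: \<theta>_eq exp_add[symmetric])
    finally show ?thesis by (simp add: \<psi>c)
  qed

  show "\<exists>v>0. \<forall>c\<ge>0. (\<integral>\<^sup>+\<omega>. time_integral (\<lambda>t. \<psi>x t \<omega> * \<gamma> t \<omega>)
            + ennreal c * stieltjes (\<lambda>t. \<psi>c t \<omega>) (\<lambda>t. \<theta> t \<omega>) \<partial>M) = ennreal (v * (\<alpha> / \<beta> + c))"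
  proof (intro exI[of _ "r * v1"] conjI allI impI)
    show "0 < r * v1" using r v1 by simp
    fix c :: real assume c: "0 \<le> c"
    have k\<delta>: "0 \<le> k / (\<delta> * v2)" using kpos \<delta>pos v2 by simp
    have "(\<integral>\<^sup>+\<omega>. time_integral (\<lambda>t. \<psi>x t \<omega> * \<gamma> t \<omega>)
            + ennreal c * stieltjes (\<lambda>t. \<psi>c t \<omega>) (\<lambda>t. \<theta> t \<omega>) \<partial>M) =
        (\<integral>\<^sup>+\<omega>. ennreal (k / (\<delta> * v2)) * discounted l \<mu> \<omega> + ennreal (c * r) * discounted l 0 \<omega> \<partial>M)"
    proof (rule nn_integral_cong_AE, use good in eventually_elim)
      fix \<omega> assume \<omega>: "\<omega> \<in> space M \<and> (\<forall>t. W t \<omega> = - B t \<omega>)"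
      then have "time_integral (\<lambda>t. \<psi>x t \<omega> * \<gamma> t \<omega>) = ennreal (k / (\<delta> * v2)) * discounted l \<mu> \<omega>"
        by (intro time_integral_cmult_discounted k\<delta> \<gamma>_eq) auto
      then show "time_integral (\<lambda>t. \<psi>x t \<omega> * \<gamma> t \<omega>) + ennreal c * stieltjes (\<lambda>t. \<psi>c t \<omega>) (\<lambda>t. \<theta> t \<omega>) =
          ennreal (k / (\<delta> * v2)) * discounted l \<mu> \<omega> + ennreal (c * r) * discounted l 0 \<omega>"
        using \<omega> c r by (simp add: stieltjes_eq ennreal_mult' mult.assoc)
    qed
    also have "\<dots> = ennreal (k / (\<delta> * v2)) * ennreal (r * v1 * v2) + ennreal (c * r) * ennreal v1"
      by (simp add: nn_integral_add nn_integral_cmult nn_integral_discounted v1 v12)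
    also have "\<dots> = ennreal (k / (\<delta> * v2) * (r * v1 * v2) + c * r * v1)"
      using kpos \<delta>pos c r v1(2) v2(2) by (subst ennreal_plus) (simp_all add: ennreal_mult'[symmetric])
    \<comment> \<open>Here \<open>v2\<close> cancels against \<open>A_const\<close>, and
      \<open>k / \<delta>\<close> leaves \<alpha> / \<beta>.\<close>
    also have "k / (\<delta> * v2) * (r * v1 * v2) + c * r * v1 = r * v1 * (\<alpha> / \<beta> + c)"
      using kpos v2 \<alpha> \<beta> by (simp add: \<delta>_def field_simps)
    finally show "(\<integral>\<^sup>+\<omega>. time_integral (\<lambda>t. \<psi>x t \<omega> * \<gamma> t \<omega>)
            + ennreal c * stieltjes (\<lambda>t. \<psi>c t \<omega>) (\<lambda>t. \<theta> t \<omega>) \<partial>M) = ennreal (r * v1 * (\<alpha> / \<beta> + c))" .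
  qed
qed

text \<open>After expansion by n, the denominator of \<kappa> differs from that of \<open>l0\<close>
  only in counting the private cost n times. With private to public cost in the ratio \<alpha> to
  \<beta>, this gives (\<alpha> + \<beta>) / (n \<alpha> + \<beta>).\<close>

theorem proposition5p5:
  fixes M :: "'a measure" and F :: "real \<Rightarrow> 'a measure"
    and W \<E>x \<psi>x \<psi>c \<gamma> \<theta> :: "real \<Rightarrow> 'a \<Rightarrow> real"
    and n :: nat and r \<sigma> \<alpha> \<beta> w l0 \<kappa> :: real
  assumes "usual_conditions M F" and "brownian_motion M F W"
    and "n \<ge> 1" and "w > 0" and "r > 0" and "\<sigma> > 0"
    and "0 < \<alpha>" and "\<alpha> < 1" and "0 < \<beta>" and "\<beta> < 1" and "\<alpha> + \<beta> < 1"
    and "sqrt (2 * r) > \<sigma> * \<alpha> / (1 - \<alpha> - \<beta>)"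
    and "\<E>x = (\<lambda>t \<omega>. exp (\<sigma> * W t \<omega>))"
    and "\<psi>x = (\<lambda>t \<omega>. exp (- r * t) * \<E>x t \<omega>)"
    and "\<psi>c = (\<lambda>t \<omega>. exp (- r * t))"
    and "\<theta> = theta_process \<alpha> \<beta> \<E>x"
    and "\<gamma> = gamma_process M r \<alpha> \<beta> \<E>x"
    and "l0 = l0_const M n w \<psi>x \<psi>c \<gamma> \<theta>"
    and "\<kappa> = kappa_const M n w \<psi>x \<psi>c \<gamma> \<theta>"
  shows "(AE \<omega> in M. \<forall>t\<ge>0. (\<kappa> * \<theta> t \<omega>) / (l0 * \<theta> t \<omega>) = \<kappa> / l0) \<and>
    (\<forall>xs Cs xh Ch.
       planner_optimal M F n w r \<alpha> \<beta> \<psi>x \<psi>c xs Cs \<and>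
       (AE \<omega> in M. \<forall>t\<ge>0. aggregate n Cs t \<omega> = l0 * \<theta> t \<omega>) \<and>
       symmetric_nash_equilibrium M F n w r \<alpha> \<beta> \<psi>x \<psi>c xh Ch \<and>
       (AE \<omega> in M. \<forall>t\<ge>0. aggregate n Ch t \<omega> = \<kappa> * \<theta> t \<omega>) \<longrightarrow>
       (AE \<omega> in M. \<forall>t\<ge>0. aggregate n Ch t \<omega> / aggregate n Cs t \<omega> = \<kappa> / l0)) \<and>
    \<kappa> / l0 = (\<alpha> + \<beta>) / (real n * \<alpha> + \<beta>) \<and>
    (\<alpha> + \<beta>) / (real n * \<alpha> + \<beta>) \<le> 1"
proof (intro conjI allI impI)
  note core = expected_cost_explicit[OF assms(1,2,5,6,7,9,11-17)]
  obtain v where v: "0 < v" and D: "\<And>c. 0 \<le> c \<Longrightarrow>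
      (\<integral>\<^sup>+\<omega>. time_integral (\<lambda>t. \<psi>x t \<omega> * \<gamma> t \<omega>)
            + ennreal c * stieltjes (\<lambda>t. \<psi>c t \<omega>) (\<lambda>t. \<theta> t \<omega>) \<partial>M) = ennreal (v * (\<alpha> / \<beta> + c))"
    using core(2) by blast
  show ratio: "AE \<omega> in M. \<forall>t\<ge>0. (\<kappa> * \<theta> t \<omega>) / (l0 * \<theta> t \<omega>) = \<kappa> / l0"
    using core(1)
  proof eventually_elim
    case (elim \<omega>)
    show ?case
    proof (intro allI impI)
      fix t :: real assume "0 \<le> t"
      \<comment> \<open>Division by zero yields 0, so cancelling \<open>\<theta> t \<omega>\<close>
        requires that it be nonzero.\<close>
      with elim have "\<theta> t \<omega> \<noteq> 0" by (metis less_irrefl)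
      then show "(\<kappa> * \<theta> t \<omega>) / (l0 * \<theta> t \<omega>) = \<kappa> / l0" by simp
    qed
  qed
  have n: "0 < real n" using assms(3) by simp
  have "l0 = real n * w / (v * (\<alpha> / \<beta> + 1))"
    using D[of 1] v assms(7,9) by (simp add: assms(18) l0_const_def)
  moreover have "\<kappa> = w / (v * (\<alpha> / \<beta> + 1 / real n))"
    using D[of "1 / real n"] v assms(7,9) by (simp add: assms(19) kappa_const_def)
  ultimately have "\<kappa> / l0 = (\<alpha> / \<beta> + 1) / (real n * (\<alpha> / \<beta> + 1 / real n))"
    using v assms(4) by simp
  also have "\<dots> = (\<alpha> + \<beta>) / (real n * \<alpha> + \<beta>)"
  proof -
    have "\<alpha> / \<beta> + 1 = (\<alpha> + \<beta>) / \<beta>" "real n * (\<alpha> / \<beta> + 1 / real n) = (real n * \<alpha> + \<beta>) / \<beta>"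
      using n assms(9) by (simp_all add: field_simps)
    then show ?thesis using assms(9) by simp
  qed
  finally show "\<kappa> / l0 = (\<alpha> + \<beta>) / (real n * \<alpha> + \<beta>)" .
  have "1 * \<alpha> \<le> real n * \<alpha>"
    using assms(3,7) by (intro mult_right_mono) auto
  moreover have "0 < real n * \<alpha> + \<beta>"
    using n assms(7,9) by (intro add_pos_pos mult_pos_pos)
  ultimately show "(\<alpha> + \<beta>) / (real n * \<alpha> + \<beta>) \<le> 1"
    by simp
  fix xs Cs xh Ch
  assume *: "planner_optimal M F n w r \<alpha> \<beta> \<psi>x \<psi>c xs Cs \<and>
       (AE \<omega> in M. \<forall>t\<ge>0. aggregate n Cs t \<omega> = l0 * \<theta> t \<omega>) \<and>
       symmetric_nash_equilibrium M F n w r \<alpha> \<beta> \<psi>x \<psi>c xh Ch \<and>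
       (AE \<omega> in M. \<forall>t\<ge>0. aggregate n Ch t \<omega> = \<kappa> * \<theta> t \<omega>)"
  then have "AE \<omega> in M. \<forall>t\<ge>0. aggregate n Cs t \<omega> = l0 * \<theta> t \<omega>"
    "AE \<omega> in M. \<forall>t\<ge>0. aggregate n Ch t \<omega> = \<kappa> * \<theta> t \<omega>" by auto
  with ratio show "AE \<omega> in M. \<forall>t\<ge>0. aggregate n Ch t \<omega> / aggregate n Cs t \<omega> = \<kappa> / l0"
    by eventually_elim simp
qed

end
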